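(* Let $\phi\in H^1(\Omega)$ be monotonic on the interval $\Omega$, let $p\ge 1$, and let $\|\cdot\|_{\mathcal H}$ be a norm induced by an inner product $(\cdot,\cdot)_{\mathcal H}$. Let $\phi^h\in\mathcal V^h_{D;p,0}$ be a solution of the constrained best approximation problem $$\phi^h=\underset{\theta^h\in\mathcal K_{p,0}}{\rm arginf}\ \|\phi-\theta^h\|_{\mathcal H},\qquad \mathcal K_{p,0}:=\left\{\theta^h\in\mathcal V^h_{D;p,0}:\ \mathscr G_{\phi,K_j}(\theta^h)\le 0,\ j=1,\dots,n_{\rm el}\right\}.$$ Then $\phi^h$ is a monotonic interpolant of $\phi$; that is, $\phi^h$ is monotonic on $\Omega$ and coincides with $\phi$ at all element boundary nodes.
   Context: $\Omega\subset\mathbb R$ is a bounded open interval, ${\rm D}$ denotes the (weak) derivative. The domain is the image $\Omega=F(\hat\Omega)$ of $\hat\Omega=(-1,1)$ under a continuously differentiable map $F$ with continuously differentiable inverse. The knots $-1=\zeta_1<\dots<\zeta_m=1$ define elements $K_j=F((\zeta_j,\zeta_{j+1}))$, $j=1,\dots,n_{\rm el}=m-1$; the element boundary nodes are the points $F(\zeta_j)$. The finite element space $\mathcal V^h_{p,0}$ consists of the continuous functions $v$ on $\Omega$ such that $v\circ F$ is a polynomial of degree at most $p$ on each $(\zeta_j,\zeta_{j+1})$. The subset $\mathcal V^h_{D;p,0}\subset\mathcal V^h_{p,0}$ consists of those functions satisfying the trace equality $v|_{\partial\Omega}=\phi|_{\partial\Omega}$. The Gibbs functional of $\phi^*$ with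 respect to $\phi$ on $\omega\subset\Omega$ is $$\mathscr G_{\phi,\omega}(\phi^* ):=\int_\omega \left(|{\rm D}\phi^*|-{\rm sgn}({\rm D}\phi^* )\,{\rm D}\phi\right){\rm d}x,$$ with ${\rm sgn}(t)=t/|t|$ for $t\ne0$ and ${\rm sgn}(0)=0$. *)

theory Defs
  imports "HOL-Analysis.Analysis"
begin

text \<open>
  Functions on an open set \<open>\<Omega>\<close> of the real line are represented by total functions on
  the reals, whose values outside \<open>\<Omega>\<close> play no role; Sobolev functions are represented
  by arbitrary members of their almost-everywhere classes.
\<close>

definition locally_integrable_on :: "(real \<Rightarrow> real) \<Rightarrow> real set \<Rightarrow> bool"
    (infix "locally'_integrable'_on" 50) where
  "u locally_integrable_on \<Omega> \<longleftrightarrow>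
     (\<forall>C. compact C \<and> C \<subseteq> \<Omega> \<longrightarrow> u absolutely_integrable_on C)"

text \<open>Smooth functions on the line with compact support in \<open>\<Omega>\<close>.\<close>

definition test_functions :: "real set \<Rightarrow> (real \<Rightarrow> real) set" where
  "test_functions \<Omega> =
     {\<eta>. (\<forall>k x. (deriv ^^ k) \<eta> differentiable (at x)) \<and>
         (\<exists>C. compact C \<and> C \<subseteq> \<Omega> \<and> (\<forall>x. x \<notin> C \<longrightarrow> \<eta> x = 0))}"

definition has_weak_deriv :: "real set \<Rightarrow> (real \<Rightarrow> real) \<Rightarrow> (real \<Rightarrow> real) \<Rightarrow> bool" where
  "has_weak_deriv \<Omega> u g \<longleftrightarrow>
     u locally_integrable_on \<Omega> \<and> g locally_integrable_on \<Omega> \<and>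
     (\<forall>\<eta>\<in>test_functions \<Omega>.
        (LINT x|lebesgue_on \<Omega>. u x * deriv \<eta> x) = - (LINT x|lebesgue_on \<Omega>. g x * \<eta> x))"

text \<open>
  A weak derivative is unique only up to null sets; the choice made here does not affect
  integrals of expressions in it.
\<close>

definition weak_deriv :: "real set \<Rightarrow> (real \<Rightarrow> real) \<Rightarrow> real \<Rightarrow> real" where
  "weak_deriv \<Omega> u = (SOME g. has_weak_deriv \<Omega> u g)"

definition L2 :: "real set \<Rightarrow> (real \<Rightarrow> real) set" where
  "L2 \<Omega> = {u. u \<in> borel_measurable (lebesgue_on \<Omega>) \<and>
              integrable (lebesgue_on \<Omega>) (\<lambda>x. (u x)\<^sup>2)}"

definition H1 :: "real set \<Rightarrow> (real \<Rightarrow> real) set" where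
  "H1 \<Omega> = {u \<in> L2 \<Omega>. \<exists>g \<in> L2 \<Omega>. has_weak_deriv \<Omega> u g}"

text \<open>
  The representative of \<open>u\<close> that is continuous up to the boundary. On a bounded open
  interval it exists for every function in \<open>H1 \<Omega>\<close> and for the finite element functions
  below, and its values on \<open>closure \<Omega>\<close> are uniquely determined. Its values are the point values of \<open>u\<close>, and on \<open>frontier \<Omega>\<close> the
  trace of \<open>u\<close>.
\<close>

definition cont_rep :: "real set \<Rightarrow> (real \<Rightarrow> real) \<Rightarrow> real \<Rightarrow> real" where
  "cont_rep \<Omega> u =
     (SOME w. continuous_on (closure \<Omega>) w \<and> (AE x in lebesgue_on \<Omega>. w x = u x))"

definition monotonic_on :: "real set \<Rightarrow> (real \<Rightarrow> real) \<Rightarrow> bool" where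
  "monotonic_on A u \<longleftrightarrow> mono_on A u \<or> antimono_on A u"

definition gibbs :: "real set \<Rightarrow> (real \<Rightarrow> real) \<Rightarrow> real set \<Rightarrow> (real \<Rightarrow> real) \<Rightarrow> real" where
  "gibbs \<Omega> \<phi> \<omega> u =
     (LINT x|lebesgue_on \<omega>.
        \<bar>weak_deriv \<Omega> u x\<bar> - sgn (weak_deriv \<Omega> u x) * weak_deriv \<Omega> \<phi> x)"

definition C1_diffeomorphism :: "real set \<Rightarrow> real set \<Rightarrow> (real \<Rightarrow> real) \<Rightarrow> bool" where
  "C1_diffeomorphism U V F \<longleftrightarrow>
     F ` U = V \<and> F C1_differentiable_on U \<and>
     (\<exists>G. G C1_differentiable_on V \<and> (\<forall>x\<in>U. G (F x) = x) \<and> (\<forall>y\<in>V. F (G y) = y))"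

text \<open>
  The reference interval is \<open>(-1,1)\<close>. The nodes \<open>F (-1)\<close> and \<open>F 1\<close> refer to the
  continuous extension of \<open>F\<close> to the closed reference interval.
\<close>

definition parametrizes :: "(real \<Rightarrow> real) \<Rightarrow> real set \<Rightarrow> bool" where
  "parametrizes F \<Omega> \<longleftrightarrow>
     C1_diffeomorphism {-1<..<1} \<Omega> F \<and> continuous_on {-1..1} F"

definition knots :: "nat \<Rightarrow> (nat \<Rightarrow> real) \<Rightarrow> bool" where
  "knots m \<zeta> \<longleftrightarrow> 2 \<le> m \<and> \<zeta> 1 = -1 \<and> \<zeta> m = 1 \<and> strict_mono_on {1..m} \<zeta>"

definition element :: "(real \<Rightarrow> real) \<Rightarrow> (nat \<Rightarrow> real) \<Rightarrow> nat \<Rightarrow> real set" where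
  "element F \<zeta> j = F ` {\<zeta> j<..<\<zeta> (j + 1)}"

definition V_space ::
    "real set \<Rightarrow> (real \<Rightarrow> real) \<Rightarrow> nat \<Rightarrow> (nat \<Rightarrow> real) \<Rightarrow> nat \<Rightarrow> (real \<Rightarrow> real) set" where
  "V_space \<Omega> F m \<zeta> p =
     {v. continuous_on \<Omega> v \<and>
         (\<forall>j\<in>{1..m - 1}. \<exists>q. degree q \<le> p \<and>
            (\<forall>t\<in>{\<zeta> j<..<\<zeta> (j + 1)}. (v \<circ> F) t = poly q t))}"

definition V_D_space ::
    "real set \<Rightarrow> (real \<Rightarrow> real) \<Rightarrow> nat \<Rightarrow> (nat \<Rightarrow> real) \<Rightarrow> nat \<Rightarrow> (real \<Rightarrow> real) \<Rightarrow>
     (real \<Rightarrow> real) set" where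
  "V_D_space \<Omega> F m \<zeta> p \<phi> =
     {v \<in> V_space \<Omega> F m \<zeta> p. \<forall>x\<in>frontier \<Omega>. cont_rep \<Omega> v x = cont_rep \<Omega> \<phi> x}"

definition K_set ::
    "real set \<Rightarrow> (real \<Rightarrow> real) \<Rightarrow> nat \<Rightarrow> (nat \<Rightarrow> real) \<Rightarrow> nat \<Rightarrow> (real \<Rightarrow> real) \<Rightarrow>
     (real \<Rightarrow> real) set" where
  "K_set \<Omega> F m \<zeta> p \<phi> =
     {\<theta> \<in> V_D_space \<Omega> F m \<zeta> p \<phi>. \<forall>j\<in>{1..m - 1}. gibbs \<Omega> \<phi> (element F \<zeta> j) \<theta> \<le> 0}"

text \<open>
  A real inner product on a linear space \<open>H\<close> of functions on \<open>\<Omega>\<close>, where functions that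
  agree almost everywhere are identified: hence definiteness modulo null sets. By
  Cauchy-Schwarz, such a form is compatible with this identification.
\<close>

definition inner_product_on ::
    "real set \<Rightarrow> (real \<Rightarrow> real) set \<Rightarrow> ((real \<Rightarrow> real) \<Rightarrow> (real \<Rightarrow> real) \<Rightarrow> real) \<Rightarrow> bool" where
  "inner_product_on \<Omega> H ip \<longleftrightarrow>
     (\<lambda>x. 0) \<in> H \<and>
     (\<forall>u\<in>H. \<forall>v\<in>H. (\<lambda>x. u x + v x) \<in> H) \<and>
     (\<forall>c. \<forall>u\<in>H. (\<lambda>x. c * u x) \<in> H) \<and>
     (\<forall>u\<in>H. \<forall>v\<in>H. ip u v = ip v u) \<and>
     (\<forall>u\<in>H. \<forall>v\<in>H. \<forall>w\<in>H. ip (\<lambda>x. u x + v x) w = ip u w + ip v w) \<and>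
     (\<forall>c. \<forall>u\<in>H. \<forall>v\<in>H. ip (\<lambda>x. c * u x) v = c * ip u v) \<and>
     (\<forall>u\<in>H. 0 \<le> ip u u) \<and>
     (\<forall>u\<in>H. ip u u = 0 \<longleftrightarrow> (AE x in lebesgue_on \<Omega>. u x = 0))"

definition induced_norm ::
    "((real \<Rightarrow> real) \<Rightarrow> (real \<Rightarrow> real) \<Rightarrow> real) \<Rightarrow> (real \<Rightarrow> real) \<Rightarrow> real" where
  "induced_norm ip u = sqrt (ip u u)"

end

theory Submission
  imports Defs
begin

text \<open>
  The proof is a comparison of total variations. Let \<open>h\<close> and \<open>g\<close> be the weak derivatives of
  \<open>\<phi>h\<close> and \<open>\<phi>\<close>, and let \<open>\<tau> = 1\<close> or \<open>\<tau> = -1\<close> be the direction in which \<open>\<phi>\<close> is monotonic, so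
  that \<open>\<tau> g = \<bar>g\<bar>\<close> almost everywhere. On each element \<open>K\<close> the Gibbs constraint bounds the
  variation of \<open>\<phi>h\<close> by that of \<open>\<phi>\<close>:
  \<open>\<integral>\<^sub>K \<bar>h\<bar> \<le> \<integral>\<^sub>K sgn h g \<le> \<integral>\<^sub>K \<bar>g\<bar> = \<tau> \<integral>\<^sub>K g\<close>.
  Summed over all elements, the right-hand side is \<open>\<tau>\<close> times the difference of the boundary
  values of \<open>\<phi>\<close>. These are also the boundary values of \<open>\<phi>h\<close>, so that the total is
  \<open>\<tau> \<integral> h\<close>, which is at most \<open>\<integral> \<bar>h\<bar>\<close>. Hence all inequalities are equalities. Equality in
  \<open>\<tau> \<integral> h \<le> \<integral> \<bar>h\<bar>\<close> says that \<open>\<phi>h\<close> is monotonic in the direction \<open>\<tau>\<close>; equality on each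
  element says that \<open>\<phi>h\<close> and \<open>\<phi>\<close> have the same increment over it, and, starting from a
  boundary point of \<open>\<Omega>\<close>, one reaches every node (lemmas \<open>elementwise_variation_bound\<close> and
  \<open>K_set_monotone_interpolant\<close>).

  The analytic part makes these integrals meaningful. The weak derivative is an arbitrary
  function satisfying the defining identity, and the continuous representative an arbitrary
  choice as well, so both have to be tied together by a fundamental theorem of calculus:
  the integral of a weak derivative of \<open>u\<close> from \<open>c\<close> to \<open>d\<close> is the difference of the limits of the
  right averages of \<open>u\<close> at \<open>d\<close> and \<open>c\<close>, if these exist (lemma \<open>weak_FTC\<close>). It is obtained
  by testing with smooth approximations of a trapezoid, and letting its slopes become vertical.
  By the Lebesgue differentiation theorem the limits are the values of \<open>u\<close> at almost all points, and
  at all points if \<open>u\<close> is continuous. This yields the continuous representative of an \<open>H1\<close> function,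
  the uniqueness of weak derivatives, and their sign for monotonic functions. Finite
  element functions have their classical derivative as an integrable weak derivative
  (lemma \<open>V_space_derivative\<close>).
\<close>

section \<open>Smooth functions and bumps\<close>

definition smooth :: "(real \<Rightarrow> real) \<Rightarrow> bool" where
  "smooth f \<longleftrightarrow> (\<forall>k x. (deriv ^^ k) f differentiable (at x))"

text \<open>
  Smoothness is coinductive: it suffices to find a class of differentiable functions that contains
  \<open>f\<close> and is closed under \<open>deriv\<close>. The closure properties below come from suitable classes.
\<close>

lemma smooth_coinduct:
  assumes "P f"
    and "\<And>f x. P f \<Longrightarrow> f differentiable (at x)" and "\<And>f. P f \<Longrightarrow> P (deriv f)"
  shows "smooth f"
proof -
  have "P ((deriv ^^ k) f)" for k
    by (induction k) (use assms in auto)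
  then show ?thesis
    using assms(2) by (auto simp: smooth_def)
qed

lemma smooth_differentiable: "smooth f \<Longrightarrow> f differentiable (at x)"
  unfolding smooth_def by (metis funpow_0)

lemma smooth_deriv: "smooth f \<Longrightarrow> smooth (deriv f)"
  unfolding smooth_def by (metis funpow_swap1 funpow.simps(2) comp_apply)

lemma smooth_DERIV: "smooth f \<Longrightarrow> (f has_real_derivative deriv f x) (at x)"
  using smooth_differentiable DERIV_deriv_iff_real_differentiable by blast

lemma smooth_continuous_on: "smooth f \<Longrightarrow> continuous_on S f"
  by (meson smooth_DERIV DERIV_continuous_on has_field_derivative_at_within)

lemma smooth_antiderivative:
  assumes "smooth f" "\<And>x. (h has_real_derivative f x) (at x)"
  shows "smooth h"
proof -
  have "deriv h = f"
    using assms(2) by (auto intro!: DERIV_imp_deriv)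
  moreover have "h differentiable (at x)" for x
    using assms(2) real_differentiable_def by blast
  ultimately show ?thesis
    by (intro smooth_coinduct[of "\<lambda>u. u = h \<or> smooth u"])
      (use assms(1) smooth_deriv smooth_differentiable in auto)
qed

lemma smooth_diff:
  assumes "smooth f" "smooth g" shows "smooth (\<lambda>x. f x - g x)"
proof (rule smooth_coinduct[of "\<lambda>u. \<exists>f g. smooth f \<and> smooth g \<and> u = (\<lambda>x. f x - g x)"])
  fix u :: "real \<Rightarrow> real" assume "\<exists>f g. smooth f \<and> smooth g \<and> u = (\<lambda>x. f x - g x)"
  then obtain f g where fg: "smooth f" "smooth g" "u = (\<lambda>x. f x - g x)" by blast
  have D: "(u has_real_derivative (deriv f x - deriv g x)) (at x)" for x
    unfolding fg(3) by (intro derivative_intros smooth_DERIV fg)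
  then have "deriv u = (\<lambda>x. deriv f x - deriv g x)"
    by (auto intro!: DERIV_imp_deriv)
  then show "\<exists>f g. smooth f \<and> smooth g \<and> deriv u = (\<lambda>x. f x - g x)"
    using fg smooth_deriv by blast
  show "u differentiable (at x)" for x
    using D real_differentiable_def by blast
qed (use assms in blast)

lemma smooth_affine:
  assumes "smooth f" shows "smooth (\<lambda>x. f (\<alpha> * x + \<beta>))"
proof (rule smooth_coinduct[of "\<lambda>u. \<exists>f c. smooth f \<and> u = (\<lambda>x. c * f (\<alpha> * x + \<beta>))"])
  show "\<exists>f' c. smooth f' \<and> (\<lambda>x. f (\<alpha> * x + \<beta>)) = (\<lambda>x. c * f' (\<alpha> * x + \<beta>))"
    using assms by (metis mult_1)
  fix u :: "real \<Rightarrow> real" assume "\<exists>f c. smooth f \<and> u = (\<lambda>x. c * f (\<alpha> * x + \<beta>))"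
  then obtain f c where f: "smooth f" "u = (\<lambda>x. c * f (\<alpha> * x + \<beta>))" by blast
  have D: "(u has_real_derivative (c * \<alpha>) * deriv f (\<alpha> * x + \<beta>)) (at x)" for x
    unfolding f(2)
    by (rule derivative_eq_intros DERIV_chain2[OF smooth_DERIV[OF f(1)]] refl | simp)+
  then have "deriv u = (\<lambda>x. (c * \<alpha>) * deriv f (\<alpha> * x + \<beta>))"
    by (auto intro!: DERIV_imp_deriv)
  then show "\<exists>f c. smooth f \<and> deriv u = (\<lambda>x. c * f (\<alpha> * x + \<beta>))"
    using f(1) smooth_deriv by blast
  show "u differentiable (at x)" for x
    using D real_differentiable_def by blast
qed

text \<open>
  The derivative of a product is a sum of two products, so products alone are not closed
  under \<open>deriv\<close>, but their sums are.
\<close>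

inductive sum_of_products :: "(real \<Rightarrow> real) \<Rightarrow> bool" where
  "smooth f \<Longrightarrow> smooth g \<Longrightarrow> sum_of_products (\<lambda>x. f x * g x)"
| "sum_of_products u \<Longrightarrow> sum_of_products v \<Longrightarrow> sum_of_products (\<lambda>x. u x + v x)"

lemma sum_of_products_DERIV:
  assumes "sum_of_products u"
  shows "\<exists>u'. sum_of_products u' \<and> (\<forall>x. (u has_real_derivative u' x) (at x))"
  using assms
proof induction
  case (1 f g)
  then have "sum_of_products (\<lambda>x. deriv f x * g x + f x * deriv g x)"
    by (intro sum_of_products.intros smooth_deriv)
  moreover have "((\<lambda>x. f x * g x) has_real_derivative (deriv f x * g x + f x * deriv g x)) (at x)" for x
    using DERIV_mult'[OF smooth_DERIV[OF 1(1)] smooth_DERIV[OF 1(2)], of x] by (simp add: add.commute)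
  ultimately show ?case by (intro exI[of _ "\<lambda>x. deriv f x * g x + f x * deriv g x"]) auto
next
  case (2 u v)
  then obtain u' v' where "sum_of_products u'" "\<forall>x. (u has_real_derivative u' x) (at x)"
    "sum_of_products v'" "\<forall>x. (v has_real_derivative v' x) (at x)" by blast
  then show ?case
    by (intro exI[of _ "\<lambda>x. u' x + v' x"] conjI allI sum_of_products.intros(2)) (auto intro!: derivative_intros)
qed

lemma smooth_mult:
  assumes "smooth f" "smooth g" shows "smooth (\<lambda>x. f x * g x)"
proof (rule smooth_coinduct[of sum_of_products])
  show "u differentiable (at x)" if "sum_of_products u" for u x
    using sum_of_products_DERIV[OF that] real_differentiable_def by blast
  show "sum_of_products (deriv u)" if u: "sum_of_products u" for u
  proof -
    obtain u' where u': "sum_of_products u'" "\<forall>x. (u has_real_derivative u' x) (at x)"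
      using sum_of_products_DERIV[OF u] by blast
    then have "deriv u = u'" by (auto intro!: DERIV_imp_deriv)
    with u' show ?thesis by simp
  qed
qed (use assms sum_of_products.intros in auto)

text \<open>
  With \<open>r = 1\<close> this is the standard smooth function that vanishes to infinite order at \<open>0\<close>. The
  polynomial factor makes the family closed under differentiation.
\<close>

definition flat_exp :: "real poly \<Rightarrow> real \<Rightarrow> real" where
  "flat_exp r x = (if 0 < x then poly r (1/x) * exp (- (1/x)) else 0)"

lemma poly_exp_tendsto_0: "((\<lambda>y. poly r y * exp (- y)) \<longlongrightarrow> (0::real)) at_top"
proof -
  have "((\<lambda>y. \<Sum>i\<le>degree r. coeff r i * (y ^ i / exp y)) \<longlongrightarrow> (\<Sum>i\<le>degree r. coeff r i * 0)) at_top"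
    by (intro tendsto_intros tendsto_power_div_exp_0)
  then show ?thesis
    by (simp add: poly_altdef sum_distrib_right exp_minus divide_inverse mult.assoc)
qed

lemma flat_exp_DERIV:
  "(flat_exp r has_real_derivative flat_exp ([:0, 0, 1:] * (r - pderiv r)) x) (at x)"
proof -
  consider "x < 0" | "x > 0" | "x = 0" by linarith
  then show ?thesis
  proof cases
    case 1
    have "((\<lambda>x. 0) has_real_derivative flat_exp ([:0, 0, 1:] * (r - pderiv r)) x) (at x)"
      using 1 by (simp add: flat_exp_def)
    then show ?thesis
      by (rule has_field_derivative_transform_within_open[where S="{..<0}"])
        (use 1 in \<open>auto simp: flat_exp_def\<close>)
  next
    case 2
    have "((\<lambda>x. poly r (1/x) * exp (- (1/x))) has_real_derivative
        flat_exp ([:0, 0, 1:] * (r - pderiv r)) x) (at x)"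
      using 2 by (auto intro!: derivative_eq_intros DERIV_chain2[OF poly_DERIV]
          simp: flat_exp_def field_simps power2_eq_square)
    then show ?thesis
      by (rule has_field_derivative_transform_within_open[where S="{0<..}"])
        (use 2 in \<open>auto simp: flat_exp_def\<close>)
  next
    case 3
    have "((\<lambda>h. poly ([:0, 1:] * r) (1/h) * exp (- (1/h))) \<longlongrightarrow> 0) (at_right 0)"
      using filterlim_compose[OF poly_exp_tendsto_0[of "[:0, 1:] * r"] filterlim_inverse_at_top_right]
      by (simp add: inverse_eq_divide)
    then have "((\<lambda>h. flat_exp r h / h) \<longlongrightarrow> 0) (at_right 0)"
      by (rule Lim_transform_eventually) (auto simp: flat_exp_def eventually_at_filter)
    moreover have "((\<lambda>h. flat_exp r h / h) \<longlongrightarrow> 0) (at_left 0)"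
      by (rule Lim_transform_eventually[OF tendsto_const]) (auto simp: flat_exp_def eventually_at_filter)
    ultimately have "((\<lambda>h. flat_exp r h / h) \<longlongrightarrow> 0) (at 0)"
      by (simp add: filterlim_split_at)
    then show ?thesis
      using 3 by (simp add: DERIV_def flat_exp_def)
  qed
qed

lemma smooth_flat_exp: "smooth (flat_exp r)"
proof (rule smooth_coinduct[of "\<lambda>u. \<exists>r. u = flat_exp r"])
  fix u :: "real \<Rightarrow> real" assume "\<exists>r. u = flat_exp r"
  then obtain r where r: "u = flat_exp r" by blast
  have "deriv u = flat_exp ([:0, 0, 1:] * (r - pderiv r))"
    unfolding r using flat_exp_DERIV by (auto intro!: DERIV_imp_deriv)
  then show "\<exists>r. deriv u = flat_exp r" by blast
  show "u differentiable (at x)" for x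
    unfolding r using flat_exp_DERIV real_differentiable_def by blast
qed auto

text \<open>
  Two copies of \<open>exp (-1/x)\<close>, steepened by the factor \<open>n\<close> and facing each other, give smooth
  functions that vanish exactly outside the interval and increase to \<open>1\<close> inside.
\<close>

lemma smooth_indicator_approx:
  fixes h :: real
  obtains s :: "nat \<Rightarrow> real \<Rightarrow> real"
  where "\<And>n. smooth (s n)" "\<And>n x. 0 \<le> s n x" "\<And>n x. s n x \<le> 1"
    "\<And>n x. x \<notin> {0<..<h} \<Longrightarrow> s n x = 0"
    "\<And>x. (\<lambda>n. s n x) \<longlonglongrightarrow> indicator {0<..<h} x"
proof
  define e where "e = flat_exp 1"
  define s where "s n x = e (real (Suc n) * x) * e (real (Suc n) * (h - x))" for n x
  have e: "0 \<le> e x" "e x \<le> 1" "x \<le> 0 \<Longrightarrow> e x = 0" for x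
    by (auto simp: e_def flat_exp_def)
  have e_sm: "smooth e" by (simp add: e_def smooth_flat_exp)
  show "smooth (s n)" for n
    using smooth_mult[OF smooth_affine[OF e_sm, of "real (Suc n)" 0]
        smooth_affine[OF e_sm, of "- real (Suc n)" "real (Suc n) * h"]]
    by (simp add: s_def[abs_def] algebra_simps)
  show "0 \<le> s n x" "s n x \<le> 1" for n x
    by (auto simp: s_def e intro: mult_le_one)
  show z: "s n x = 0" if "x \<notin> {0<..<h}" for n x
  proof -
    have "real (Suc n) * x \<le> 0 \<or> real (Suc n) * (h - x) \<le> 0"
      using that by (auto simp: mult_le_0_iff)
    then show ?thesis by (auto simp: s_def e)
  qed
  have lim: "(\<lambda>n. e (real (Suc n) * y)) \<longlonglongrightarrow> 1" if "0 < y" for y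
  proof -
    have "(\<lambda>n. exp (- (inverse (real (Suc n)) * (1 / y)))) \<longlonglongrightarrow> exp (- (0 * (1/y)))"
      by (intro tendsto_intros LIMSEQ_inverse_real_of_nat)
    moreover have "0 < real (Suc n) * y" for n
      using that by simp
    ultimately show ?thesis
      by (simp add: e_def flat_exp_def divide_inverse del: of_nat_Suc)
  qed
  show "(\<lambda>n. s n x) \<longlonglongrightarrow> indicator {0<..<h} x" for x
  proof (cases "x \<in> {0<..<h}")
    case True
    then show ?thesis
      using tendsto_mult[OF lim[of x] lim[of "h - x"]] by (simp add: s_def)
  next
    case False
    then show ?thesis by (simp add: z)
  qed
qed

section \<open>Right averages of locally integrable functions\<close>

lemma locally_integrable_onD:
  assumes "u locally_integrable_on {a<..<b}" "a < x" "y < b"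
  shows "u absolutely_integrable_on {x..y}"
proof -
  have "{x..y} \<subseteq> {a<..<b}"
    using assms(2,3) by auto
  then show ?thesis
    using assms(1) compact_Icc unfolding locally_integrable_on_def by blast
qed

lemma AE_lebesgue_on_iff:
  assumes "S \<in> sets lebesgue"
  shows "(AE x in lebesgue_on S. P x) \<longleftrightarrow> (\<exists>N. negligible N \<and> (\<forall>x\<in>S - N. P x))"
proof -
  have "(AE x in lebesgue_on S. P x) \<longleftrightarrow> (AE x in lebesgue. x \<in> S \<longrightarrow> P x)"
    using assms by (intro AE_restrict_space_iff) auto
  also have "\<dots> \<longleftrightarrow> (\<exists>N. negligible N \<and> {x. \<not> (x \<in> S \<longrightarrow> P x)} \<subseteq> N)"
    by (simp add: eventually_ae_filter_negligible)
  also have "\<dots> \<longleftrightarrow> (\<exists>N. negligible N \<and> (\<forall>x\<in>S - N. P x))"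
    by blast
  finally show ?thesis .
qed

text \<open>
  The averages at \<open>x\<close> depend on \<open>u\<close> near \<open>x\<close> only. So the differentiation theorem for integrable
  functions applies to the restrictions of \<open>u\<close> to an exhausting sequence of compact intervals,
  and the exceptional null sets are united.
\<close>

lemma Lebesgue_differentiation_right:
  assumes "u locally_integrable_on {a<..<b}"
  obtains N where "negligible N"
    "\<And>x. x \<in> {a<..<b} - N \<Longrightarrow> ((\<lambda>h. integral {x..x + h} u / h) \<longlongrightarrow> u x) (at_right 0)"
proof -
  define I where "I n = {a + inverse (real (Suc n))..b - inverse (real (Suc n))}" for n
  define f where "f n x = (if x \<in> I n then u x else 0)" for n x
  have "\<exists>N. negligible N \<and> (\<forall>x e. x \<notin> N \<longrightarrow> 0 < e \<longrightarrow>
      (\<exists>d>0. \<forall>h. 0 < h \<and> h < d \<longrightarrow> norm (integral {x..x + h} (f n) / h - f n x) < e))" for n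
  proof -
    have I: "u absolutely_integrable_on I n"
      unfolding I_def by (rule locally_integrable_onD[OF assms]) (auto simp: add_strict_increasing)
    then have "f n absolutely_integrable_on UNIV"
      unfolding f_def absolutely_integrable_restrict_UNIV .
    then have "f n integrable_on UNIV"
      using set_lebesgue_integral_eq_integral(1) by blast
    then have "f n integrable_on cbox p q" for p q
      by (rule integrable_on_subcbox) auto
    from integrable_ccontinuous_explicit[OF this] obtain N where "negligible N"
      "\<And>x e. \<lbrakk>x \<notin> N; 0 < e\<rbrakk> \<Longrightarrow> \<exists>d>0. \<forall>h. 0 < h \<and> h < d \<longrightarrow>
         norm (integral (cbox x (x + h *\<^sub>R One)) (f n) /\<^sub>R h ^ DIM(real) - f n x) < e"
      by blast
    then show ?thesis
      by (intro exI[of _ N]) (simp add: divide_inverse mult.commute)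
  qed
  then obtain N where N: "\<And>n. negligible (N n)"
    "\<And>n x e. x \<notin> N n \<Longrightarrow> 0 < e \<Longrightarrow>
      \<exists>d>0. \<forall>h. 0 < h \<and> h < d \<longrightarrow> norm (integral {x..x + h} (f n) / h - f n x) < e"
    by metis
  show ?thesis
  proof
    show "negligible (\<Union>n. N n)"
      using N(1) by (intro negligible_Union_nat)
    fix x assume x: "x \<in> {a<..<b} - (\<Union>n. N n)"
    then obtain n where n: "inverse (real (Suc n)) < min (x - a) (b - x)"
      using reals_Archimedean[of "min (x - a) (b - x)"] by auto
    define d0 where "d0 = b - inverse (real (Suc n)) - x"
    have d0: "0 < d0" and fx: "f n x = u x"
      using n by (auto simp: d0_def f_def I_def)
    have eq: "integral {x..x + h} (f n) = integral {x..x + h} u" if "h < d0" for h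
      by (rule integral_cong) (use that n in \<open>auto simp: d0_def f_def I_def\<close>)
    show "((\<lambda>h. integral {x..x + h} u / h) \<longlongrightarrow> u x) (at_right 0)"
    proof (rule tendstoI)
      fix e :: real assume "0 < e"
      with N(2)[of x n e] x obtain d where d: "d > 0"
        "\<And>h. 0 < h \<Longrightarrow> h < d \<Longrightarrow> norm (integral {x..x + h} (f n) / h - f n x) < e"
        by auto
      show "\<forall>\<^sub>F h in at_right 0. dist (integral {x..x + h} u / h) (u x) < e"
        unfolding eventually_at_right_field
        using d d0 by (intro exI[of _ "min d d0"]) (auto simp: dist_norm eq[symmetric] fx[symmetric])
    qed
  qed
qed

lemma AE_nonneg_if_interval_integrals_nonneg:
  assumes "u locally_integrable_on {a<..<b}"
    and "\<And>x y. a < x \<Longrightarrow> x < y \<Longrightarrow> y < b \<Longrightarrow> 0 \<le> integral {x..y} u"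
  obtains N where "negligible N" "\<And>x. x \<in> {a<..<b} - N \<Longrightarrow> 0 \<le> u x"
proof -
  obtain N where N: "negligible N"
    "\<And>x. x \<in> {a<..<b} - N \<Longrightarrow> ((\<lambda>h. integral {x..x + h} u / h) \<longlongrightarrow> u x) (at_right 0)"
    using Lebesgue_differentiation_right[OF assms(1)] by blast
  have "0 \<le> u x" if x: "x \<in> {a<..<b} - N" for x
  proof (rule tendsto_lowerbound[OF N(2)[OF x]])
    show "\<forall>\<^sub>F h in at_right 0. 0 \<le> integral {x..x + h} u / h"
      unfolding eventually_at_right_field
      using x assms(2)[of x] by (intro exI[of _ "b - x"]) auto
  qed auto
  with N(1) that show thesis by blast
qed

lemma AE_eq_if_interval_integrals_eq:
  assumes "u locally_integrable_on {a<..<b}" "v locally_integrable_on {a<..<b}"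
    and "\<And>x y. a < x \<Longrightarrow> x < y \<Longrightarrow> y < b \<Longrightarrow> integral {x..y} u = integral {x..y} v"
  obtains N where "negligible N" "\<And>x. x \<in> {a<..<b} - N \<Longrightarrow> u x = v x"
proof -
  obtain N where N: "negligible N"
    "\<And>x. x \<in> {a<..<b} - N \<Longrightarrow> ((\<lambda>h. integral {x..x + h} u / h) \<longlongrightarrow> u x) (at_right 0)"
    using Lebesgue_differentiation_right[OF assms(1)] by blast
  obtain N' where N': "negligible N'"
    "\<And>x. x \<in> {a<..<b} - N' \<Longrightarrow> ((\<lambda>h. integral {x..x + h} v / h) \<longlongrightarrow> v x) (at_right 0)"
    using Lebesgue_differentiation_right[OF assms(2)] by blast
  show thesis
  proof
    show "negligible (N \<union> N')" using N(1) N'(1) by (rule negligible_Un)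
    fix x assume x: "x \<in> {a<..<b} - (N \<union> N')"
    have "((\<lambda>h. integral {x..x + h} u / h) \<longlongrightarrow> v x) (at_right 0)"
    proof (rule Lim_transform_eventually)
      show "((\<lambda>h. integral {x..x + h} v / h) \<longlongrightarrow> v x) (at_right 0)"
        using x N'(2) by blast
      show "\<forall>\<^sub>F h in at_right 0. integral {x..x + h} v / h = integral {x..x + h} u / h"
        unfolding eventually_at_right_field
        using x assms(3)[of x] by (intro exI[of _ "b - x"]) auto
    qed
    with N(2)[of x] x show "u x = v x"
      by (intro tendsto_unique[of "at_right 0"]) auto
  qed
qed

text \<open>
  At every point, the averages of \<open>u\<close> see its continuous version: this is how point values
  are recovered from a function that is given up to null sets.
\<close>

lemma right_averages_tendsto_continuous:
  fixes u w :: "real \<Rightarrow> real"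
  assumes "continuous_on {a<..<b} w" "AE x in lebesgue_on {a<..<b}. w x = u x" "x \<in> {a<..<b}"
  shows "((\<lambda>h. integral {x..x + h} u / h) \<longlongrightarrow> w x) (at_right 0)"
proof -
  have cont: "continuous_on {x..y} w" if "y < b" for y
    by (rule continuous_on_subset[OF assms(1)]) (use that assms(3) in auto)
  define y where "y = (x + b) / 2"
  have y: "x < y" "y < b" using assms(3) by (auto simp: y_def)
  obtain N where N: "negligible N" "\<And>z. z \<in> {a<..<b} - N \<Longrightarrow> w z = u z"
    using assms(2) by (auto simp: AE_lebesgue_on_iff)
  have eq: "integral {x..x + h} u = integral {x..x + h} w" if "h < b - x" for h
    by (rule integral_spike[OF N(1)]) (use that assms(3) N(2) in auto)
  have "((\<lambda>v. integral {x..v} w) has_real_derivative w x) (at x within {x..y})"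
    using y by (intro integral_has_real_derivative cont) auto
  then have "((\<lambda>h. (integral {x..h} w - integral {x..x} w) / (h - x)) \<longlongrightarrow> w x) (at x within {x..y})"
    by (simp add: has_field_derivative_iff)
  then have "((\<lambda>h. integral {x..h} w / (h - x)) \<longlongrightarrow> w x) (at_right x)"
    using y by (simp add: at_within_Icc_at_right)
  then have "((\<lambda>h. integral {x..x + h} w / h) \<longlongrightarrow> w x) (at_right 0)"
    by (simp add: filterlim_at_right_to_0[of _ _ x] add.commute)
  then show ?thesis
    by (rule Lim_transform_eventually)
      (unfold eventually_at_right_field, use assms(3) in \<open>auto intro!: exI[of _ "b - x"] simp: eq\<close>)
qed

section \<open>A fundamental theorem of calculus for weak derivatives\<close>

lemma locally_integrable_mult_continuous:
  assumes "u locally_integrable_on {a<..<b}" "a < x" "y < b" "continuous_on {x..y} f"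
  shows "(\<lambda>t. u t * f t) absolutely_integrable_on {x..y}"
proof -
  have "(\<lambda>t. f t * u t) absolutely_integrable_on {x..y}"
  proof (rule absolutely_integrable_bounded_measurable_product_real)
    show "f \<in> borel_measurable (lebesgue_on {x..y})"
      by (intro continuous_imp_measurable_on_sets_lebesgue assms) auto
    show "bounded (f ` {x..y})"
      by (intro compact_imp_bounded compact_continuous_image assms) auto
  qed (use locally_integrable_onD assms in auto)
  then show ?thesis by (simp add: mult.commute)
qed

lemma LINT_eq_integral_if_zero_outside:
  fixes f :: "real \<Rightarrow> real"
  assumes "f absolutely_integrable_on C" "C \<subseteq> S" "S \<in> sets lebesgue" "\<And>x. x \<in> S - C \<Longrightarrow> f x = 0"
  shows "(LINT x|lebesgue_on S. f x) = integral C f"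
proof -
  have e: "{x \<in> C - S. f x \<noteq> 0} = {}" "{x \<in> S - C. f x \<noteq> 0} = {}"
    using assms(2,4) by auto
  have "f absolutely_integrable_on S"
    by (rule absolutely_integrable_spike_set[OF assms(1)]) (simp_all only: e negligible_empty)
  then have "(LINT x|lebesgue_on S. f x) = integral S f"
    using absolutely_integrable_imp_integrable assms(3) lebesgue_integral_eq_integral by blast
  also have "\<dots> = integral C f"
    by (rule integral_spike_set) (simp_all only: e negligible_empty)
  finally show ?thesis .
qed

text \<open>
  The primitive of a bump: it rises from \<open>0\<close> to a constant on \<open>[0, h]\<close>. The difference of two of its
  translates is a test function.
\<close>

lemma smooth_transition:
  assumes "smooth s" "\<And>x. 0 \<le> s x" "\<And>x. s x \<le> 1" "\<And>x. x \<notin> {0<..<h} \<Longrightarrow> s x = 0" "0 < h"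
  defines "A \<equiv> \<lambda>x. integral {0..x} s"
  shows "\<And>x. (A has_real_derivative s x) (at x)" "\<And>x. x \<le> 0 \<Longrightarrow> A x = 0"
    "\<And>x. h \<le> x \<Longrightarrow> A x = A h" "\<And>x. 0 \<le> A x" "\<And>x. A x \<le> h"
proof -
  have int: "s integrable_on {x..y}" for x y
    by (intro integrable_continuous_real smooth_continuous_on assms)
  show A0: "A x = 0" if "x \<le> 0" for x
    using that by (cases "x = 0") (auto simp: A_def)
  show Ah: "A x = A h" if "h \<le> x" for x
  proof -
    have "integral {0..h} s + integral {h..x} s = A x"
      unfolding A_def using that \<open>0 < h\<close> by (intro Henstock_Kurzweil_Integration.integral_combine int) auto
    moreover have "integral {h..x} s = integral {h..x} (\<lambda>x. 0)"
      by (rule integral_cong) (use assms(4) in auto)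
    ultimately show ?thesis by (simp add: A_def)
  qed
  show "0 \<le> A x" for x
    unfolding A_def by (intro integral_nonneg int assms)
  show "A x \<le> h" for x
  proof (cases "x \<le> h")
    case True
    have "A x \<le> integral {0..x} (\<lambda>x. 1)"
      unfolding A_def by (intro integral_le int assms) auto
    then show ?thesis using True \<open>0 < h\<close> by (cases "x \<ge> 0") (auto simp: A_def)
  next
    case False
    have "A h \<le> integral {0..h} (\<lambda>x. 1)"
      unfolding A_def by (intro integral_le int assms) auto
    then show ?thesis using False \<open>0 < h\<close> Ah[of x] by simp
  qed
  \<comment> \<open>The lower limit is moved to the left of \<open>x\<close>, so that \<open>x\<close> is interior also when \<open>x \<le> 0\<close>.\<close>
  have eq: "A y = integral {min 0 (x - 1)..y} s" if "x - 1 < y" for x y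
  proof -
    have z: "integral {min 0 (x - 1)..t} s = 0" if "t \<le> 0" for t
    proof -
      have "integral {min 0 (x - 1)..t} s = integral {min 0 (x - 1)..t} (\<lambda>x. 0)"
        by (rule integral_cong) (use assms(4) that in auto)
      then show ?thesis by simp
    qed
    show ?thesis
    proof (cases "y \<le> 0")
      case True then show ?thesis using z A0 by simp
    next
      case False
      then have "integral {min 0 (x - 1)..0} s + integral {0..y} s = integral {min 0 (x - 1)..y} s"
        by (intro Henstock_Kurzweil_Integration.integral_combine int) auto
      then show ?thesis using z[of 0] by (simp add: A_def)
    qed
  qed
  show "(A has_real_derivative s x) (at x)" for x
  proof -
    have "((\<lambda>y. integral {min 0 (x - 1)..y} s) has_real_derivative s x) (at x within {min 0 (x - 1)..x + 1})"
      by (intro integral_has_real_derivative smooth_continuous_on assms) auto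
    then have "((\<lambda>y. integral {min 0 (x - 1)..y} s) has_real_derivative s x) (at x)"
      by (subst (asm) at_within_interior) auto
    then show ?thesis
      by (rule has_field_derivative_transform_within_open[where S="{x - 1<..<x + 1}"]) (use eq in auto)
  qed
qed

lemma integral_mult_indicator_Ioo:
  fixes u :: "real \<Rightarrow> real"
  assumes "{p..q} \<subseteq> {x..y}"
  shows "integral {x..y} (\<lambda>t. u t * indicator {p<..<q} t) = integral {p..q} u"
proof -
  have "integral {x..y} (\<lambda>t. u t * indicator {p<..<q} t) = integral {x..y} (\<lambda>t. if t \<in> {p..q} then u t else 0)"
    by (rule integral_spike[of "{p, q}"]) (auto simp: indicator_def)
  also have "\<dots> = integral ({p..q} \<inter> {x..y}) u"
    by (rule integral_restrict_Int)
  finally show ?thesis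
    using inf.absorb1[OF assms] by (simp only:)
qed

text \<open>
  The defining identity of the weak derivative for a Lipschitz function that is not smooth: the
  trapezoid that rises with slope \<open>1\<close> on \<open>[c, c + h]\<close> and falls with slope \<open>-1\<close> on \<open>[d, d + h]\<close>.
  Its derivative is a difference of two indicators, which are limits of smooth bumps with
  values in \<open>[0, 1]\<close>; both sides pass to the limit by dominated convergence. The two bumps are
  translates of each other, so that the primitive of their difference has compact support.
\<close>

lemma weak_deriv_ramp_identity:
  assumes wd: "has_weak_deriv {a<..<b} u g"
    and "a < c" "c < d" "0 < h" "d + h \<le> e" "e < b"
  shows "integral {c..c + h} u - integral {d..d + h} u =
    - integral {c..e} (\<lambda>x. g x * (max 0 (min (x - c) h) - max 0 (min (x - d) h)))"
proof -
  have u: "u locally_integrable_on {a<..<b}" and g: "g locally_integrable_on {a<..<b}"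
    using wd by (auto simp: has_weak_deriv_def)
  obtain s :: "nat \<Rightarrow> real \<Rightarrow> real" where s: "\<And>n. smooth (s n)" "\<And>n x. 0 \<le> s n x" "\<And>n x. s n x \<le> 1"
    "\<And>n x. x \<notin> {0<..<h} \<Longrightarrow> s n x = 0"
    "\<And>x. (\<lambda>n. s n x) \<longlonglongrightarrow> indicator {0<..<h} x"
    using smooth_indicator_approx[of h] by blast
  define A where "A n x = integral {0..x} (s n)" for n x
  note A = smooth_transition[OF s(1-4) \<open>0 < h\<close>, folded A_def]
  define \<eta> where "\<eta> n x = A n (x - c) - A n (x - d)" for n x
  define \<eta>' where "\<eta>' n x = s n (x - c) - s n (x - d)" for n x
  have s_shift: "smooth (\<lambda>x. s n (x - k))" for n k
    using smooth_affine[OF s(1), of n 1 "- k"] by simp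
  have \<eta>'_smooth: "smooth (\<eta>' n)" for n
    unfolding \<eta>'_def[abs_def] by (intro smooth_diff s_shift)
  have D: "(\<eta> n has_real_derivative \<eta>' n x) (at x)" for n x
    unfolding \<eta>_def[abs_def] \<eta>'_def
    by (rule derivative_eq_intros DERIV_chain2[OF A(1)] refl | simp)+
  have \<eta>_smooth: "smooth (\<eta> n)" for n
    using smooth_antiderivative[OF \<eta>'_smooth D] .
  have zero: "\<eta> n x = 0" "\<eta>' n x = 0" if x: "x \<notin> {c..e}" for n x
  proof -
    consider "x < c" | "e < x" using x by fastforce
    then show "\<eta> n x = 0" "\<eta>' n x = 0"
      using assms A(2)[of "x - c" n] A(2)[of "x - d" n] A(3)[of "x - c" n] A(3)[of "x - d" n]
        s(4)[of "x - c" n] s(4)[of "x - d" n]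
      by (cases; simp add: \<eta>_def \<eta>'_def)+
  qed
  have sub: "{c..e} \<subseteq> {a<..<b}" using assms by auto
  have "\<eta> n \<in> test_functions {a<..<b}" for n
    using \<eta>_smooth[of n] zero(1) sub unfolding test_functions_def smooth_def by blast
  moreover have "deriv (\<eta> n) = \<eta>' n" for n
    using D by (auto intro!: DERIV_imp_deriv)
  ultimately have weak: "(LINT x|lebesgue_on {a<..<b}. u x * \<eta>' n x) = - (LINT x|lebesgue_on {a<..<b}. g x * \<eta> n x)" for n
    using wd unfolding has_weak_deriv_def by metis
  have ai: "(\<lambda>x. u x * \<eta>' n x) absolutely_integrable_on {c..e}" "(\<lambda>x. g x * \<eta> n x) absolutely_integrable_on {c..e}" for n
    using assms by (intro locally_integrable_mult_continuous[OF u] locally_integrable_mult_continuous[OF g]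
        smooth_continuous_on \<eta>_smooth \<eta>'_smooth; simp)+
  have eq: "integral {c..e} (\<lambda>x. u x * \<eta>' n x) = - integral {c..e} (\<lambda>x. g x * \<eta> n x)" for n
  proof -
    have "(LINT x|lebesgue_on {a<..<b}. u x * \<eta>' n x) = integral {c..e} (\<lambda>x. u x * \<eta>' n x)"
      by (rule LINT_eq_integral_if_zero_outside[OF ai(1) sub]) (use zero in auto)
    moreover have "(LINT x|lebesgue_on {a<..<b}. g x * \<eta> n x) = integral {c..e} (\<lambda>x. g x * \<eta> n x)"
      by (rule LINT_eq_integral_if_zero_outside[OF ai(2) sub]) (use zero in auto)
    ultimately show ?thesis
      using weak[of n] by simp
  qed
  have absu: "(\<lambda>x. \<bar>u x\<bar>) integrable_on {c..e}" and absg: "(\<lambda>x. \<bar>g x\<bar>) integrable_on {c..e}"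
    using locally_integrable_onD[OF u, of c e] locally_integrable_onD[OF g, of c e] assms
    by (auto simp: absolutely_integrable_on_def)
  let ?I = "\<lambda>x. indicat_real {c<..<c + h} x - indicat_real {d<..<d + h} x"
  have L1: "(\<lambda>n. integral {c..e} (\<lambda>x. u x * \<eta>' n x)) \<longlonglongrightarrow> integral {c..e} (\<lambda>x. u x * ?I x)"
  proof (rule dominated_convergence(2)[OF _ absu])
    show "norm (u x * \<eta>' n x) \<le> \<bar>u x\<bar>" for n x
    proof -
      have "\<bar>\<eta>' n x\<bar> \<le> 1"
        using s(2)[of n "x - c"] s(3)[of n "x - c"] s(2)[of n "x - d"] s(3)[of n "x - d"]
        by (auto simp: \<eta>'_def)
      then show ?thesis by (simp add: abs_mult mult_left_le)
    qed
    show "(\<lambda>n. u x * \<eta>' n x) \<longlonglongrightarrow> u x * ?I x" for x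
    proof -
      have "(\<lambda>n. u x * \<eta>' n x) \<longlonglongrightarrow> u x * (indicator {0<..<h} (x - c) - indicator {0<..<h} (x - d))"
        unfolding \<eta>'_def by (intro tendsto_intros s)
      then show ?thesis by (simp add: indicator_def algebra_simps)
    qed
  qed (use ai set_lebesgue_integral_eq_integral in blast)
  let ?r = "\<lambda>x. max 0 (min x h)"
  have A_lim: "(\<lambda>n. A n x) \<longlonglongrightarrow> ?r x" for x
  proof (cases "x \<le> 0")
    case True
    then show ?thesis using A(2) \<open>0 < h\<close> by simp
  next
    case False
    have "(\<lambda>n. integral {0..x} (s n)) \<longlonglongrightarrow> integral {0..x} (indicat_real {0<..<h})"
    proof (rule dominated_convergence(2)[where h="\<lambda>x. 1"])
      show "s n integrable_on {0..x}" for n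
        by (intro integrable_continuous_real smooth_continuous_on s)
    qed (use s in auto)
    also have "integral {0..x} (indicat_real {0<..<h}) = integral {0..x} (\<lambda>t. 1 * indicator {0<..<min x h} t)"
      by (rule integral_spike[of "{x}"]) (auto simp: indicator_def)
    also have "\<dots> = integral {0..min x h} (\<lambda>t. 1)"
      by (rule integral_mult_indicator_Ioo) auto
    also have "\<dots> = ?r x"
      using False \<open>0 < h\<close> by simp
    finally show ?thesis by (simp add: A_def)
  qed
  have L2: "(\<lambda>n. integral {c..e} (\<lambda>x. g x * \<eta> n x)) \<longlonglongrightarrow> integral {c..e} (\<lambda>x. g x * (?r (x - c) - ?r (x - d)))"
  proof (rule dominated_convergence(2))
    show "(\<lambda>x. \<bar>g x\<bar> * h) integrable_on {c..e}"
      by (intro integrable_on_mult_left absg)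
    show "norm (g x * \<eta> n x) \<le> \<bar>g x\<bar> * h" for n x
    proof -
      have "\<bar>\<eta> n x\<bar> \<le> h"
        using A(4)[of n "x - c"] A(5)[of n "x - c"] A(4)[of n "x - d"] A(5)[of n "x - d"]
        by (auto simp: \<eta>_def)
      then show ?thesis by (simp add: abs_mult mult_left_mono)
    qed
    show "(\<lambda>n. g x * \<eta> n x) \<longlonglongrightarrow> g x * (?r (x - c) - ?r (x - d))" for x
      unfolding \<eta>_def by (intro tendsto_intros A_lim)
  qed (use ai set_lebesgue_integral_eq_integral in blast)
  have "integral {c..e} (\<lambda>x. u x * ?I x) = - integral {c..e} (\<lambda>x. g x * (?r (x - c) - ?r (x - d)))"
    using LIMSEQ_unique[OF L1[unfolded eq] tendsto_minus[OF L2]] by linarith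
  moreover have "integral {c..e} (\<lambda>x. u x * ?I x) = integral {c..c + h} u - integral {d..d + h} u"
  proof -
    have "(\<lambda>x. u x * indicator {p<..<q} x) integrable_on {c..e}" for p q
    proof -
      have "(\<lambda>x. indicat_real {p<..<q} x * u x) absolutely_integrable_on {c..e}"
      proof (rule absolutely_integrable_bounded_measurable_product_real)
        show "indicat_real {p<..<q} \<in> borel_measurable (lebesgue_on {c..e})"
          by (intro measurable_restrict_space1 borel_measurable_indicator) simp
        show "bounded (indicat_real {p<..<q} ` {c..e})"
          by (auto simp: bounded_iff indicator_def intro!: exI[of _ 1])
      qed (use locally_integrable_onD[OF u] assms in auto)
      then show ?thesis
        using set_lebesgue_integral_eq_integral(1) by (subst mult.commute) blast
    qed
    then have "integral {c..e} (\<lambda>x. u x * ?I x) =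
        integral {c..e} (\<lambda>x. u x * indicator {c<..<c + h} x) - integral {c..e} (\<lambda>x. u x * indicator {d<..<d + h} x)"
      by (simp add: right_diff_distrib integral_diff)
    also have "\<dots> = integral {c..c + h} u - integral {d..d + h} u"
      using assms by (subst (1 2) integral_mult_indicator_Ioo) auto
    finally show ?thesis .
  qed
  ultimately show ?thesis by simp
qed

text \<open>
  The trapezoid identity, divided by \<open>h\<close>: as \<open>h\<close> tends to \<open>0\<close>, the left-hand side becomes a
  difference of limits of averages, and the normalized trapezoid tends to the indicator
  of \<open>(c, d]\<close>.
\<close>

lemma weak_FTC:
  assumes wd: "has_weak_deriv {a<..<b} u g"
    and "a < c" "c < d" "d < b"
    and lc: "((\<lambda>h. integral {c..c + h} u / h) \<longlongrightarrow> uc) (at_right 0)"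
    and ld: "((\<lambda>h. integral {d..d + h} u / h) \<longlongrightarrow> ud) (at_right 0)"
  shows "integral {c..d} g = ud - uc"
proof -
  have g: "g locally_integrable_on {a<..<b}"
    using wd by (auto simp: has_weak_deriv_def)
  define e where "e = (d + b) / 2"
  have e: "d < e" "e < b" using assms by (auto simp: e_def)
  \<comment> \<open>the factor \<open>e - d\<close> keeps \<open>[d, d + h n]\<close> inside \<open>[c, e]\<close> for all \<open>n\<close>\<close>
  define h where "h n = (e - d) * inverse (real (Suc n))" for n
  have h: "0 < h n" "d + h n \<le> e" for n
    using e mult_left_le[of "inverse (real (Suc n))" "e - d"] by (auto simp: h_def field_simps)
  have h_lim: "h \<longlonglongrightarrow> 0"
    using tendsto_mult[OF tendsto_const LIMSEQ_inverse_real_of_nat, of "e - d"] by (simp add: h_def[abs_def])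
  moreover have "h n \<noteq> 0" for n
    using h(1)[of n] by simp
  ultimately have h_at: "filterlim h (at_right 0) sequentially"
    unfolding filterlim_at using h(1) by simp
  let ?r = "\<lambda>n x. max 0 (min x (h n)) / h n"
  have id: "integral {c..c + h n} u / h n - integral {d..d + h n} u / h n =
      - integral {c..e} (\<lambda>x. g x * (?r n (x - c) - ?r n (x - d)))" for n
  proof -
    have "integral {c..e} (\<lambda>x. g x * (?r n (x - c) - ?r n (x - d))) =
        integral {c..e} (\<lambda>x. g x * (max 0 (min (x - c) (h n)) - max 0 (min (x - d) (h n))) / h n)"
      by (intro integral_cong) (simp only: right_diff_distrib diff_divide_distrib times_divide_eq_right)
    also have "\<dots> = integral {c..e} (\<lambda>x. g x * (max 0 (min (x - c) (h n)) - max 0 (min (x - d) (h n)))) / h n"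
      by (rule integral_divide)
    finally show ?thesis
      using weak_deriv_ramp_identity[OF wd \<open>a < c\<close> \<open>c < d\<close> h(1) h(2) e(2), of n]
      by (simp only: diff_divide_distrib[symmetric] minus_divide_left)
  qed
  have L1: "(\<lambda>n. integral {c..c + h n} u / h n - integral {d..d + h n} u / h n) \<longlonglongrightarrow> uc - ud"
    by (intro tendsto_diff filterlim_compose[OF lc h_at] filterlim_compose[OF ld h_at])
  have absg: "(\<lambda>x. \<bar>g x\<bar>) integrable_on {c..e}"
    using locally_integrable_onD[OF g, of c e] assms e
    by (auto simp: absolutely_integrable_on_def)
  have r_bounds: "0 \<le> ?r n x" "?r n x \<le> 1" for n x
    using h(1)[of n] by auto
  have r_lim: "(\<lambda>n. ?r n x) \<longlonglongrightarrow> indicator {0<..} x" for x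
  proof (cases "0 < x")
    case True
    have "\<forall>\<^sub>F n in sequentially. h n < x"
      using h_lim True by (rule order_tendstoD)
    then have "\<forall>\<^sub>F n in sequentially. 1 = ?r n x"
    proof (rule eventually_mono)
      show "1 = ?r n x" if "h n < x" for n
        using that h(1)[of n] by (simp add: min_def max_def)
    qed
    with True show ?thesis
      by (auto intro: Lim_transform_eventually[OF tendsto_const])
  qed auto
  have L2: "(\<lambda>n. integral {c..e} (\<lambda>x. g x * (?r n (x - c) - ?r n (x - d)))) \<longlonglongrightarrow>
      integral {c..e} (\<lambda>x. g x * (indicator {0<..} (x - c) - indicator {0<..} (x - d)))"
  proof (rule dominated_convergence(2)[OF _ absg])
    show "norm (g x * (?r n (x - c) - ?r n (x - d))) \<le> \<bar>g x\<bar>" for n x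
    proof -
      have "\<bar>?r n (x - c) - ?r n (x - d)\<bar> \<le> 1"
        using r_bounds[of "x - c" n] r_bounds[of "x - d" n] by linarith
      then show ?thesis by (simp only: real_norm_def abs_mult) (simp add: mult_left_le)
    qed
    show "(\<lambda>n. g x * (?r n (x - c) - ?r n (x - d))) \<longlonglongrightarrow>
        g x * (indicator {0<..} (x - c) - indicator {0<..} (x - d))" for x
      by (intro tendsto_mult tendsto_diff tendsto_const r_lim)
    show "(\<lambda>x. g x * (?r n (x - c) - ?r n (x - d))) integrable_on {c..e}" for n
    proof -
      have "(\<lambda>x. g x * (?r n (x - c) - ?r n (x - d))) absolutely_integrable_on {c..e}"
        using assms e h(1)[of n] by (intro locally_integrable_mult_continuous[OF g] continuous_intros) auto
      then show ?thesis using set_lebesgue_integral_eq_integral by blast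
    qed
  qed
  have "integral {c..e} (\<lambda>x. g x * (indicator {0<..} (x - c) - indicator {0<..} (x - d))) = ud - uc"
    using LIMSEQ_unique[OF L1[unfolded id] tendsto_minus[OF L2]] by linarith
  moreover have "integral {c..e} (\<lambda>x. g x * (indicator {0<..} (x - c) - indicator {0<..} (x - d))) =
      integral {c..e} (\<lambda>x. g x * indicator {c<..<d} x)"
    by (rule integral_spike[of "{d}"]) (use \<open>c < d\<close> in \<open>auto simp: indicator_def\<close>)
  ultimately show ?thesis
    using e \<open>c < d\<close> by (simp add: integral_mult_indicator_Ioo)
qed

section \<open>Continuous representatives and classical derivatives\<close>

lemma absolutely_integrable_on_Ioo_imp_Icc:
  fixes g :: "real \<Rightarrow> real"
  assumes "g absolutely_integrable_on {a<..<b}" "a \<le> x" "y \<le> b"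
  shows "g absolutely_integrable_on {x..y}"
proof (rule absolutely_integrable_on_subinterval)
  show "g absolutely_integrable_on {a..b}"
    using assms(1) by (simp add: absolutely_integrable_on_Icc_iff_Ioo)
qed (use assms in auto)

text \<open>
  The primitive of \<open>g\<close>, with the constant fixed by the value of \<open>u\<close> at a Lebesgue point \<open>c\<close>,
  agrees with \<open>u\<close> at every Lebesgue point.
\<close>

lemma weak_deriv_primitive:
  assumes "has_weak_deriv {a<..<b} u g" "g absolutely_integrable_on {a<..<b}" "a < b"
  obtains w where "continuous_on {a..b} w" "AE x in lebesgue_on {a<..<b}. w x = u x"
proof -
  have g: "g integrable_on {x..y}" if "a \<le> x" "y \<le> b" for x y
    using absolutely_integrable_on_Ioo_imp_Icc[OF assms(2) that] set_lebesgue_integral_eq_integral(1) by blast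
  obtain N where N: "negligible N"
    "\<And>x. x \<in> {a<..<b} - N \<Longrightarrow> ((\<lambda>h. integral {x..x + h} u / h) \<longlongrightarrow> u x) (at_right 0)"
    using Lebesgue_differentiation_right assms(1) unfolding has_weak_deriv_def by blast
  have "\<not> {a<..<b} \<subseteq> N"
    using open_not_negligible[of "{a<..<b}"] negligible_subset[OF N(1)] \<open>a < b\<close> by auto
  then obtain c where c: "c \<in> {a<..<b} - N" by blast
  define w where "w x = u c - integral {a..c} g + integral {a..x} g" for x
  have step: "integral {a..y} g - integral {a..x} g = u y - u x"
    if xy: "x \<in> {a<..<b} - N" "y \<in> {a<..<b} - N" "x < y" for x y
  proof -
    have "integral {a..x} g + integral {x..y} g = integral {a..y} g"
      using xy by (intro Henstock_Kurzweil_Integration.integral_combine g) auto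
    moreover have "integral {x..y} g = u y - u x"
      using xy by (intro weak_FTC[OF assms(1)] N(2)) auto
    ultimately show ?thesis by simp
  qed
  show thesis
  proof
    show "continuous_on {a..b} w"
      unfolding w_def by (intro continuous_intros indefinite_integral_continuous_1 g) auto
    have "w x = u x" if "x \<in> {a<..<b} - N" for x
      using step[OF that c] step[OF c that] by (cases x c rule: linorder_cases) (auto simp: w_def)
    then show "AE x in lebesgue_on {a<..<b}. w x = u x"
      using N(1) by (auto simp: AE_lebesgue_on_iff)
  qed
qed

lemma weak_FTC_continuous:
  assumes "has_weak_deriv {a<..<b} u g"
    and "continuous_on {a<..<b} w" "AE x in lebesgue_on {a<..<b}. w x = u x"
    and "a < x" "x < y" "y < b"
  shows "integral {x..y} g = w y - w x"
  using assms(4-6) by (intro weak_FTC[OF assms(1)] right_averages_tendsto_continuous[OF assms(2,3)]) auto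

lemma weak_FTC_closed:
  assumes "has_weak_deriv {a<..<b} u g" "g absolutely_integrable_on {a<..<b}"
    and "continuous_on {a..b} w" "AE x in lebesgue_on {a<..<b}. w x = u x"
    and "a < b" "a \<le> x" "x \<le> y" "y \<le> b"
  shows "integral {x..y} g = w y - w x"
proof -
  have g: "g integrable_on {x..y}" if "a \<le> x" "y \<le> b" for x y
    using absolutely_integrable_on_Ioo_imp_Icc[OF assms(2) that] set_lebesgue_integral_eq_integral(1) by blast
  have cont: "continuous_on {a<..<b} w"
    by (rule continuous_on_subset[OF assms(3)]) auto
  define c where "c = (a + b) / 2"
  have c: "a < c" "c < b" using \<open>a < b\<close> by (auto simp: c_def)
  define k where "k = w c - integral {a..c} g"
  have comb: "integral {a..s} g + integral {s..t} g = integral {a..t} g" if "a \<le> s" "s \<le> t" "t \<le> b" for s t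
    using that by (intro Henstock_Kurzweil_Integration.integral_combine g) auto
  have "w t - integral {a..t} g = k" if "t \<in> {a..b}" for t
  proof (rule continuous_constant_on_closure[of "{a<..<b}" "\<lambda>t. w t - integral {a..t} g"])
    show "continuous_on (closure {a<..<b}) (\<lambda>t. w t - integral {a..t} g)"
      using \<open>a < b\<close> by (auto intro!: continuous_intros indefinite_integral_continuous_1 g assms(3))
    show "w t - integral {a..t} g = k" if "t \<in> {a<..<b}" for t
      using that c weak_FTC_continuous[OF assms(1) cont assms(4), of t c]
        weak_FTC_continuous[OF assms(1) cont assms(4), of c t] comb[of t c] comb[of c t]
      by (cases t c rule: linorder_cases) (auto simp: k_def)
  qed (use that \<open>a < b\<close> in auto)
  from this[of x] this[of y] comb[of x y] assms show ?thesis by auto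
qed


text \<open>
  Integrability of one weak derivative supplies a continuous version of \<open>u\<close>, whose increments
  are the integrals of either weak derivative over each interval.
\<close>

lemma weak_deriv_AE_unique:
  assumes "has_weak_deriv {a<..<b} u g" "has_weak_deriv {a<..<b} u g'"
    and "g absolutely_integrable_on {a<..<b}" "a < b"
  obtains N where "negligible N" "\<And>x. x \<in> {a<..<b} - N \<Longrightarrow> g x = g' x"
proof -
  obtain w where "continuous_on {a..b} w" and w: "AE x in lebesgue_on {a<..<b}. w x = u x"
    using weak_deriv_primitive[OF assms(1,3,4)] by blast
  then have cont: "continuous_on {a<..<b} w"
    by (auto intro: continuous_on_subset)
  have "integral {x..y} g = integral {x..y} g'" if "a < x" "x < y" "y < b" for x y
    using weak_FTC_continuous[OF assms(1) cont w that] weak_FTC_continuous[OF assms(2) cont w that] by simp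
  then show thesis
    using AE_eq_if_interval_integrals_eq[of g a b g'] assms(1,2) that
    unfolding has_weak_deriv_def by blast
qed

text \<open>
  The situation common to \<open>H1\<close> functions and finite element functions. Having one integrable
  weak derivative is enough to control the representatives selected by \<open>weak_deriv\<close> and
  \<open>cont_rep\<close>.
\<close>

locale integrable_weak_deriv =
  fixes a b :: real and u g :: "real \<Rightarrow> real"
  assumes less: "a < b" and weak: "has_weak_deriv {a<..<b} u g"
    and integrable: "g absolutely_integrable_on {a<..<b}"
begin

lemma has_weak_deriv_weak_deriv: "has_weak_deriv {a<..<b} u (weak_deriv {a<..<b} u)"
  unfolding weak_deriv_def using weak by (rule someI[where P="has_weak_deriv {a<..<b} u"])

lemma absolutely_integrable_weak_deriv: "weak_deriv {a<..<b} u absolutely_integrable_on {a<..<b}"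
proof -
  obtain N where "negligible N" "\<And>x. x \<in> {a<..<b} - N \<Longrightarrow> g x = weak_deriv {a<..<b} u x"
    using weak_deriv_AE_unique[OF weak has_weak_deriv_weak_deriv integrable less] by blast
  then show ?thesis
    by (intro absolutely_integrable_spike[OF integrable]) auto
qed

lemma cont_rep: "continuous_on {a..b} (cont_rep {a<..<b} u)"
    "AE x in lebesgue_on {a<..<b}. cont_rep {a<..<b} u x = u x"
proof -
  obtain w where "continuous_on {a..b} w" "AE x in lebesgue_on {a<..<b}. w x = u x"
    using weak_deriv_primitive[OF weak integrable less] by blast
  then have "\<exists>w. continuous_on (closure {a<..<b}) w \<and> (AE x in lebesgue_on {a<..<b}. w x = u x)"
    using less by auto
  then have "continuous_on (closure {a<..<b}) (cont_rep {a<..<b} u) \<and>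
      (AE x in lebesgue_on {a<..<b}. cont_rep {a<..<b} u x = u x)"
    unfolding cont_rep_def by (rule someI_ex)
  then show "continuous_on {a..b} (cont_rep {a<..<b} u)"
    "AE x in lebesgue_on {a<..<b}. cont_rep {a<..<b} u x = u x"
    using less by auto
qed

lemma integral_weak_deriv:
  assumes "a \<le> x" "x \<le> y" "y \<le> b"
  shows "integral {x..y} (weak_deriv {a<..<b} u) = cont_rep {a<..<b} u y - cont_rep {a<..<b} u x"
  using weak_FTC_closed[OF has_weak_deriv_weak_deriv absolutely_integrable_weak_deriv cont_rep less assms] .

end

lemma H1_integrable_weak_deriv:
  assumes "\<phi> \<in> H1 {a<..<b}" "a < b"
  obtains g where "integrable_weak_deriv a b \<phi> g"
proof -
  obtain g where g: "g \<in> L2 {a<..<b}" "has_weak_deriv {a<..<b} \<phi> g"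
    using assms(1) by (auto simp: H1_def)
  have "g absolutely_integrable_on {a<..<b}"
  proof (rule measurable_bounded_by_integrable_imp_absolutely_integrable)
    show "g \<in> borel_measurable (lebesgue_on {a<..<b})"
      using g(1) by (simp add: L2_def)
    have "(\<lambda>x. (g x)\<^sup>2) integrable_on {a<..<b}"
      using g(1) by (intro integrable_on_lebesgue_on) (auto simp: L2_def)
    then show "(\<lambda>x. 1 + (g x)\<^sup>2) integrable_on {a<..<b}"
      by (intro integrable_add) (auto intro: integrable_on_const)
    show "norm (g x) \<le> 1 + (g x)\<^sup>2" for x
      using sum_squares_bound[of "\<bar>g x\<bar>" 1] by (simp add: power2_eq_square)
  qed auto
  with g(2) assms(2) that show thesis
    by (auto simp: integrable_weak_deriv_def)
qed

lemma compact_subset_Ioo_bounds: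
  fixes a b :: real
  assumes "compact C" "C \<subseteq> {a<..<b}" "a < b"
  obtains c d where "a < c" "c < d" "d < b" "C \<subseteq> {c<..<d}"
proof (cases "C = {}")
  case True
  obtain c d where "a < c" "c < d" "d < b"
    using dense \<open>a < b\<close> by metis
  with True that show thesis by blast
next
  case False
  have ends: "Inf C \<in> {a<..<b}" "Sup C \<in> {a<..<b}"
    using assms False by (meson subsetD closed_contains_Inf closed_contains_Sup compact_imp_closed
        bounded_imp_bdd_below bounded_imp_bdd_above compact_imp_bounded)+
  then obtain c d where cd: "a < c" "c < Inf C" "Sup C < d" "d < b"
    using dense by (metis greaterThanLessThan_iff)
  have C: "Inf C \<le> x" "x \<le> Sup C" if "x \<in> C" for x
    using that assms(1) by (auto intro!: cInf_lower cSup_upper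
      intro: bounded_imp_bdd_below bounded_imp_bdd_above compact_imp_bounded)
  show thesis
  proof
    show "C \<subseteq> {c<..<d}" using C cd by fastforce
    show "c < d" using C False cd by fastforce
  qed (use cd in auto)
qed

text \<open>
  Integration by parts against a test function: the fundamental theorem of calculus for the
  product tolerates finitely many points without derivative because the product is
  continuous.
\<close>

lemma has_weak_deriv_piecewise_differentiable:
  assumes "a < b" "continuous_on {a<..<b} v" "finite S"
    and diff: "\<And>x. x \<in> {a<..<b} - S \<Longrightarrow> v differentiable (at x)"
    and int: "deriv v absolutely_integrable_on {a<..<b}"
  shows "has_weak_deriv {a<..<b} v (deriv v)"
  unfolding has_weak_deriv_def
proof (intro conjI ballI)
  have sub: "f absolutely_integrable_on C" if "f absolutely_integrable_on D" "compact C" "C \<subseteq> D" for f :: "real \<Rightarrow> real" and C D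
    using that set_integrable_subset lmeasurable_compact by blast
  show v: "v locally_integrable_on {a<..<b}"
    unfolding locally_integrable_on_def
  proof (intro allI impI)
    fix C assume C: "compact C \<and> C \<subseteq> {a<..<b}"
    show "v absolutely_integrable_on C"
    proof -
      obtain c d where "a < c" "c < d" "d < b" "C \<subseteq> {c<..<d}"
        using compact_subset_Ioo_bounds[of C a b] C \<open>a < b\<close> by blast
      then have "v absolutely_integrable_on {c..d}"
        by (intro absolutely_integrable_continuous_real continuous_on_subset[OF assms(2)]) auto
      moreover have "C \<subseteq> {c..d}"
        using \<open>C \<subseteq> {c<..<d}\<close> by force
      ultimately show ?thesis
        using C sub by blast
    qed
  qed
  show v': "deriv v locally_integrable_on {a<..<b}"
    unfolding locally_integrable_on_def using sub[OF int] by blast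
  fix \<eta> assume \<eta>: "\<eta> \<in> test_functions {a<..<b}"
  then have sm: "smooth \<eta>"
    by (auto simp: test_functions_def smooth_def)
  obtain C where C: "compact C" "C \<subseteq> {a<..<b}" "\<And>x. x \<notin> C \<Longrightarrow> \<eta> x = 0"
    using \<eta> by (auto simp: test_functions_def)
  obtain c d where cd: "a < c" "c < d" "d < b" "C \<subseteq> {c<..<d}"
    using compact_subset_Ioo_bounds[OF C(1,2) \<open>a < b\<close>] by blast
  have zero: "\<eta> x = 0" "deriv \<eta> x = 0" if "x \<notin> {c<..<d}" for x
  proof -
    have x: "x \<in> - C" using that cd(4) by auto
    then show "\<eta> x = 0" using C(3) by auto
    have "open (- C)" using C(1) compact_imp_closed by blast
    then have "(\<eta> has_real_derivative 0) (at x)"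
      using x C(3) by (intro has_field_derivative_transform_within_open[OF DERIV_const, of "- C" x 0 \<eta>]) auto
    then show "deriv \<eta> x = 0" by (rule DERIV_imp_deriv)
  qed
  have ai: "(\<lambda>x. v x * deriv \<eta> x) absolutely_integrable_on {c..d}"
    "(\<lambda>x. deriv v x * \<eta> x) absolutely_integrable_on {c..d}"
    using cd by (intro locally_integrable_mult_continuous[OF v] locally_integrable_mult_continuous[OF v']
      smooth_continuous_on smooth_deriv sm; simp)+
  have "((\<lambda>x. v x * deriv \<eta> x + deriv v x * \<eta> x) has_integral (v d * \<eta> d - v c * \<eta> c)) {c..d}"
  proof (rule fundamental_theorem_of_calculus_interior_strong[OF \<open>finite S\<close> less_imp_le[OF cd(2)]])
    show "((\<lambda>x. v x * \<eta> x) has_vector_derivative (v x * deriv \<eta> x + deriv v x * \<eta> x)) (at x)"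
      if "x \<in> {c<..<d} - S" for x
    proof -
      have "(v has_real_derivative deriv v x) (at x)"
        using diff[of x] that cd DERIV_deriv_iff_real_differentiable by auto
      from DERIV_mult'[OF this smooth_DERIV[OF sm]] show ?thesis
        by (simp add: has_real_derivative_iff_has_vector_derivative)
    qed
    show "continuous_on {c..d} (\<lambda>x. v x * \<eta> x)"
      using cd by (intro continuous_intros smooth_continuous_on sm continuous_on_subset[OF assms(2)]) auto
  qed
  then have "integral {c..d} (\<lambda>x. v x * deriv \<eta> x + deriv v x * \<eta> x) = 0"
    using zero(1)[of c] zero(1)[of d] by (simp add: integral_unique)
  then have "integral {c..d} (\<lambda>x. v x * deriv \<eta> x) = - integral {c..d} (\<lambda>x. deriv v x * \<eta> x)"
    using ai[THEN set_lebesgue_integral_eq_integral(1)] by (simp add: integral_add eq_neg_iff_add_eq_0)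
  moreover have "(LINT x|lebesgue_on {a<..<b}. v x * deriv \<eta> x) = integral {c..d} (\<lambda>x. v x * deriv \<eta> x)"
    "(LINT x|lebesgue_on {a<..<b}. deriv v x * \<eta> x) = integral {c..d} (\<lambda>x. deriv v x * \<eta> x)"
    using cd zero by (intro LINT_eq_integral_if_zero_outside[OF ai(1)] LINT_eq_integral_if_zero_outside[OF ai(2)]; auto)+
  ultimately show "(LINT x|lebesgue_on {a<..<b}. v x * deriv \<eta> x) = - (LINT x|lebesgue_on {a<..<b}. deriv v x * \<eta> x)"
    by simp
qed

section \<open>Meshes and finite element functions\<close>

lemma continuous_strict_mono_image_Ioo:
  fixes f :: "real \<Rightarrow> real"
  assumes cont: "continuous_on {p..q} f" and mono: "strict_mono_on {p<..<q} f"
    and "p \<le> s" "s < t" "t \<le> q"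
  shows "f s < f t" "f ` {s<..<t} = {f s<..<f t}"
proof -
  have closed: "f x < f y" if xy: "p \<le> x" "x < y" "y \<le> q" for x y
  proof -
    obtain k l where kl: "x < k" "k < l" "l < y"
      using dense xy(2) by metis
    have "f x \<le> f k"
    proof (rule continuous_le_on_closure[where S="{x<..<k}" and f=f and x=x and a="f k"])
      show "continuous_on (closure {x<..<k}) f"
        using kl xy by (auto intro: continuous_on_subset[OF cont])
      show "f z \<le> f k" if "z \<in> {x<..<k}" for z
        using that kl xy strict_mono_onD[OF mono, of z k] by auto
    qed (use kl in auto)
    also have "f k < f l"
      using kl xy by (intro strict_mono_onD[OF mono]) auto
    also have "f l \<le> f y"
    proof (rule continuous_ge_on_closure[where S="{l<..<y}" and f=f and x=y and a="f l"])
      show "continuous_on (closure {l<..<y}) f"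
        using kl xy by (auto intro: continuous_on_subset[OF cont])
      show "f l \<le> f z" if "z \<in> {l<..<y}" for z
        using that kl xy strict_mono_onD[OF mono, of l z] by auto
    qed (use kl in auto)
    finally show ?thesis .
  qed
  show "f s < f t" using closed assms by auto
  show "f ` {s<..<t} = {f s<..<f t}"
  proof
    show "f ` {s<..<t} \<subseteq> {f s<..<f t}"
      using closed assms by auto
    show "{f s<..<f t} \<subseteq> f ` {s<..<t}"
    proof
      fix y assume y: "y \<in> {f s<..<f t}"
      obtain x where "s \<le> x" "x \<le> t" "f x = y"
        using IVT'[of f s y t] y assms continuous_on_subset[OF cont, of "{s..t}"] by auto
      moreover from this have "x \<noteq> s" "x \<noteq> t" using y by auto
      ultimately show "y \<in> f ` {s<..<t}" by force
    qed
  qed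
qed

text \<open>
  Minimum and maximum cover increasing and decreasing functions at once, so that the orientation
  of the parametrization never has to be distinguished below.
\<close>

lemma continuous_inj_image_Ioo:
  fixes f :: "real \<Rightarrow> real"
  assumes cont: "continuous_on {p..q} f" and inj: "inj_on f {p<..<q}"
    and st: "p \<le> s" "s < t" "t \<le> q"
  shows "f s \<noteq> f t" "f ` {s<..<t} = {min (f s) (f t)<..<max (f s) (f t)}"
proof -
  have "continuous_on {p<..<q} f"
    by (rule continuous_on_subset[OF cont]) auto
  then consider "strict_mono_on {p<..<q} f" | "strict_antimono_on {p<..<q} f"
    using injective_eq_monotone_map[of "{p<..<q}" f] inj by auto
  then have "f s \<noteq> f t \<and> f ` {s<..<t} = {min (f s) (f t)<..<max (f s) (f t)}"
  proof cases
    case 1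
    then show ?thesis
      using continuous_strict_mono_image_Ioo[OF cont 1 st] by simp
  next
    case 2
    have "strict_mono_on {p<..<q} (\<lambda>x. - f x)"
      using 2 by (auto simp: monotone_on_def)
    note neg = continuous_strict_mono_image_Ioo[OF continuous_on_minus[OF cont] this st]
    have "f ` {s<..<t} = uminus ` ((\<lambda>x. - f x) ` {s<..<t})"
      by (simp add: image_image)
    also have "\<dots> = {f t<..<f s}"
      unfolding neg by simp
    finally show ?thesis using neg(1) by simp
  qed
  then show "f s \<noteq> f t" "f ` {s<..<t} = {min (f s) (f t)<..<max (f s) (f t)}" by auto
qed

locale mesh =
  fixes a b :: real and F :: "real \<Rightarrow> real" and m :: nat and \<zeta> :: "nat \<Rightarrow> real"
  assumes less: "a < b" and param: "parametrizes F {a<..<b}" and kn: "knots m \<zeta>"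
begin

lemma knot_less: "\<zeta> i < \<zeta> j" if "i \<in> {1..m}" "j \<in> {1..m}" "i < j"
  using kn strict_mono_onD[of "{1..m}" \<zeta> i j] that by (simp add: knots_def)

lemma knot_bounds: "- 1 \<le> \<zeta> j" "\<zeta> j \<le> 1" if "j \<in> {1..m}"
  using kn that knot_less[of 1 j] knot_less[of j m] by (cases "j = 1"; cases "j = m"; force simp: knots_def)+

lemma inj_F: "inj_on F {-1<..<1}"
  using param unfolding parametrizes_def C1_diffeomorphism_def by (metis inj_onI)

lemma range_F: "F ` {-1<..<1} = {a<..<b}"
  using param by (simp add: parametrizes_def C1_diffeomorphism_def)

lemma cont_F: "continuous_on {-1..1} F"
  using param by (simp add: parametrizes_def)

lemma image_F: "F ` {s<..<t} = {min (F s) (F t)<..<max (F s) (F t)}" if "- 1 \<le> s" "s < t" "t \<le> 1"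
  using continuous_inj_image_Ioo(2)[OF cont_F inj_F] that .

lemma F_ends: "min (F (-1)) (F 1) = a" "max (F (-1)) (F 1) = b"
proof -
  have "{min (F (-1)) (F 1)<..<max (F (-1)) (F 1)} = {a<..<b}"
    using image_F[of "-1" 1] range_F by simp
  then show "min (F (-1)) (F 1) = a" "max (F (-1)) (F 1) = b"
    using less by (simp_all add: greaterThanLessThan_eq_iff)
qed

lemma element_indices: "j \<in> {1..m}" "j + 1 \<in> {1..m}" if "j \<in> {1..m - 1}"
  using that by auto

lemma element_eq: "element F \<zeta> j =
    {min (F (\<zeta> j)) (F (\<zeta> (j + 1)))<..<max (F (\<zeta> j)) (F (\<zeta> (j + 1)))}" if "j \<in> {1..m - 1}"
  unfolding element_def using that knot_less[of j "j + 1"] knot_bounds[of j] knot_bounds[of "j + 1"]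
  by (intro image_F) auto

lemma knot_interval_subset: "{\<zeta> j<..<\<zeta> (j + 1)} \<subseteq> {-1<..<1}" if "j \<in> {1..m - 1}"
  using knot_bounds(1)[OF element_indices(1)[OF that]] knot_bounds(2)[OF element_indices(2)[OF that]] by auto

lemma element_subset: "element F \<zeta> j \<subseteq> {a<..<b}" if "j \<in> {1..m - 1}"
  using image_mono[OF knot_interval_subset[OF that], of F] unfolding element_def range_F .

lemma node_bounds: "a \<le> F (\<zeta> j)" "F (\<zeta> j) \<le> b" if "j \<in> {1..m}"
proof -
  have "F (\<zeta> j) \<in> F ` {-1..1}"
    using knot_bounds[OF that] by auto
  also have "{-1..1::real} = insert (-1) (insert 1 {-1<..<1})"
    by auto
  also have "F ` \<dots> \<subseteq> {a..b}"
    using F_ends less by (subst image_insert, subst image_insert, subst range_F) auto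
  finally show "a \<le> F (\<zeta> j)" "F (\<zeta> j) \<le> b" by auto
qed

lemma elements_disjoint: "element F \<zeta> i \<inter> element F \<zeta> j = {}"
  if ij: "i \<in> {1..m - 1}" "j \<in> {1..m - 1}" "i \<noteq> j"
proof -
  have "{\<zeta> i<..<\<zeta> (i + 1)} \<inter> {\<zeta> j<..<\<zeta> (j + 1)} = {}" if "i < j" "i \<in> {1..m - 1}" "j \<in> {1..m - 1}" for i j
    using that knot_less[of "i + 1" j] by (cases "i + 1 = j") fastforce+
  then have "{\<zeta> i<..<\<zeta> (i + 1)} \<inter> {\<zeta> j<..<\<zeta> (j + 1)} = {}"
    using ij by (metis Int_commute linorder_neqE_nat)
  then show ?thesis
    unfolding element_def
    using inj_on_image_Int[OF inj_F knot_interval_subset[OF ij(1)] knot_interval_subset[OF ij(2)]] by simp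
qed

lemma elements_cover: "{a<..<b} - F ` \<zeta> ` {1..m} \<subseteq> (\<Union>j\<in>{1..m - 1}. element F \<zeta> j)"
proof
  fix x assume x: "x \<in> {a<..<b} - F ` \<zeta> ` {1..m}"
  then obtain t where t: "t \<in> {-1<..<1}" "F t = x"
    using range_F by (metis DiffD1 imageE)
  have "\<exists>j\<in>{1..n - 1}. t \<in> {\<zeta> j<..<\<zeta> (j + 1)}" if "1 \<le> n" "n \<le> m" "t < \<zeta> n" for n
    using that
  proof (induction n rule: dec_induct)
    case base
    then show ?case using t kn by (simp add: knots_def)
  next
    case (step n)
    show ?case
    proof (cases "t < \<zeta> n")
      case True
      with step obtain j where "j \<in> {1..n - 1}" "t \<in> {\<zeta> j<..<\<zeta> (j + 1)}" by auto
      then show ?thesis by (intro bexI[of _ j]) auto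
    next
      case False
      moreover have "t \<noteq> \<zeta> n" using t x step by auto
      ultimately show ?thesis using step by (intro bexI[of _ n]) auto
    qed
  qed
  from this[of m] obtain j where "j \<in> {1..m - 1}" "t \<in> {\<zeta> j<..<\<zeta> (j + 1)}"
    using t kn by (auto simp: knots_def)
  then show "x \<in> (\<Union>j\<in>{1..m - 1}. element F \<zeta> j)"
    using t(2) unfolding element_def by blast
qed

lemma absolutely_integrable_on_element:
  fixes f :: "real \<Rightarrow> real"
  assumes "f absolutely_integrable_on {a<..<b}" "j \<in> {1..m - 1}"
  shows "f absolutely_integrable_on element F \<zeta> j"
  using assms element_subset[OF assms(2)] element_eq[OF assms(2)] by (intro set_integrable_subset[OF assms(1)]) auto

lemma sum_integral_elements:
  fixes f :: "real \<Rightarrow> real"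
  assumes "f absolutely_integrable_on {a<..<b}"
  shows "(\<Sum>j\<in>{1..m - 1}. integral (element F \<zeta> j) f) = integral {a<..<b} f"
proof -
  have "(f has_integral (\<Sum>j\<in>{1..m - 1}. integral (element F \<zeta> j) f)) (\<Union>j\<in>{1..m - 1}. element F \<zeta> j)"
  proof (rule has_integral_UN)
    show "(f has_integral integral (element F \<zeta> j) f) (element F \<zeta> j)" if "j \<in> {1..m - 1}" for j
      using absolutely_integrable_on_element[OF assms that] set_lebesgue_integral_eq_integral(1) by blast
    show "pairwise (\<lambda>i j. negligible (element F \<zeta> i \<inter> element F \<zeta> j)) {1..m - 1}"
      using elements_disjoint by (auto simp: pairwise_def)
  qed simp
  then have "(f has_integral (\<Sum>j\<in>{1..m - 1}. integral (element F \<zeta> j) f)) {a<..<b}"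
  proof (subst has_integral_spike_set_eq)
    show "negligible {x \<in> {a<..<b} - (\<Union>j\<in>{1..m - 1}. element F \<zeta> j). f x \<noteq> 0}"
      by (rule negligible_subset[of "F ` \<zeta> ` {1..m}"]) (use elements_cover in auto)
    have "{x \<in> (\<Union>j\<in>{1..m - 1}. element F \<zeta> j) - {a<..<b}. f x \<noteq> 0} = {}"
      using element_subset by blast
    then show "negligible {x \<in> (\<Union>j\<in>{1..m - 1}. element F \<zeta> j) - {a<..<b}. f x \<noteq> 0}"
      by (simp only: negligible_empty)
  qed
  then show ?thesis by (simp add: integral_unique)
qed

text \<open>
  Towards the boundary of \<open>\<Omega>\<close>, the derivative \<open>G'\<close> of the inverse of \<open>F\<close> may be unbounded,
  and with it the derivative of \<open>v\<close>. It is integrable nevertheless: on an element,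
  \<open>v = q \<circ> G\<close> with a polynomial \<open>q\<close>, and the change of variables by \<open>F\<close> turns \<open>deriv v\<close> into \<open>q'\<close>
  times the sign of \<open>F'\<close>, which is bounded.
\<close>

lemma V_space_derivative:
  assumes v: "v \<in> V_space {a<..<b} F m \<zeta> p"
  shows "integrable_weak_deriv a b v (deriv v)"
proof
  obtain D where D: "\<And>t. t \<in> {-1<..<1} \<Longrightarrow> (F has_real_derivative D t) (at t)" "continuous_on {-1<..<1} D"
  proof -
    obtain D where "\<forall>t\<in>{-1<..<1}. (F has_vector_derivative D t) (at t)" "continuous_on {-1<..<1} D"
      using param unfolding parametrizes_def C1_diffeomorphism_def C1_differentiable_on_def by blast
    then show thesis
      using that[of D] by (simp add: has_real_derivative_iff_has_vector_derivative)
  qed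
  obtain G G' where G: "\<And>x. x \<in> {a<..<b} \<Longrightarrow> (G has_real_derivative G' x) (at x)"
    "\<And>t. t \<in> {-1<..<1} \<Longrightarrow> G (F t) = t"
  proof -
    obtain G G' where "\<forall>x\<in>{a<..<b}. (G has_vector_derivative G' x) (at x)" "\<forall>t\<in>{-1<..<1}. G (F t) = t"
      using param unfolding parametrizes_def C1_diffeomorphism_def C1_differentiable_on_def by blast
    then show thesis
      using that[of G G'] by (simp add: has_real_derivative_iff_has_vector_derivative)
  qed
  have local: "(\<forall>x\<in>element F \<zeta> j. v differentiable (at x)) \<and> deriv v absolutely_integrable_on element F \<zeta> j"
    if j: "j \<in> {1..m - 1}" for j
  proof -
    let ?S = "{\<zeta> j<..<\<zeta> (j + 1)}"
    have S: "?S \<subseteq> {-1<..<1}" using knot_interval_subset[OF j] .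
    obtain q where q: "\<And>t. t \<in> ?S \<Longrightarrow> v (F t) = poly q t"
    proof -
      have "\<exists>q. degree q \<le> p \<and> (\<forall>t\<in>?S. (v \<circ> F) t = poly q t)"
        using v j unfolding V_space_def by blast
      then obtain q where "\<forall>t\<in>?S. (v \<circ> F) t = poly q t" by blast
      then show thesis using that[of q] by (simp only: comp_apply)
    qed
    have open_K: "open (element F \<zeta> j)" using element_eq[OF j] by simp
    have diff: "v differentiable (at x)" if x: "x \<in> element F \<zeta> j" for x
    proof -
      have "x \<in> {a<..<b}" using x element_subset[OF j] by blast
      have "((\<lambda>x. poly q (G x)) has_real_derivative poly (pderiv q) (G x) * G' x) (at x)"
        by (rule DERIV_chain2[OF poly_DERIV G(1)]) fact
      moreover have "poly q (G y) = v y" if "y \<in> element F \<zeta> j" for y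
        using that q G(2) S unfolding element_def by force
      ultimately have "(v has_real_derivative poly (pderiv q) (G x) * G' x) (at x)"
        by (rule has_field_derivative_transform_within_open[OF _ open_K x])
      then show ?thesis using real_differentiable_def by blast
    qed
    have chain: "deriv v (F t) * D t = poly (pderiv q) t" if t: "t \<in> ?S" for t
    proof -
      have "(v has_real_derivative deriv v (F t)) (at (F t))"
        using diff[of "F t"] t DERIV_deriv_iff_real_differentiable by (auto simp: element_def)
      from DERIV_chain2[OF this D(1)[of t]] t S
      have "((\<lambda>t. v (F t)) has_real_derivative deriv v (F t) * D t) (at t)" by blast
      then have "(poly q has_real_derivative deriv v (F t) * D t) (at t)"
        by (rule has_field_derivative_transform_within_open[where S="?S"]) (use t q in auto)
      then show ?thesis using poly_DERIV DERIV_unique by blast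
    qed
    have prod: "(\<lambda>t. sgn (D t) * poly (pderiv q) t) absolutely_integrable_on ?S"
    proof (rule absolutely_integrable_bounded_measurable_product_real)
      have "D \<in> borel_measurable (lebesgue_on ?S)"
        by (intro continuous_imp_measurable_on_sets_lebesgue continuous_on_subset[OF D(2) S]) auto
      then show "(\<lambda>t. sgn (D t)) \<in> borel_measurable (lebesgue_on ?S)"
        by simp
      show "bounded ((\<lambda>t. sgn (D t)) ` ?S)"
        by (auto simp: bounded_iff sgn_if intro!: exI[of _ 1])
      have "poly (pderiv q) absolutely_integrable_on {\<zeta> j..\<zeta> (j + 1)}"
        by (intro absolutely_integrable_continuous_real continuous_intros)
      then show "poly (pderiv q) absolutely_integrable_on ?S"
        by (simp add: absolutely_integrable_on_Icc_iff_Ioo)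
    qed auto
    have eq: "sgn (D t) * poly (pderiv q) t = \<bar>D t\<bar> * deriv v (F t)" if "t \<in> ?S" for t
      using chain[OF that] by (simp add: abs_sgn mult.commute mult.left_commute flip: chain)
    have "(\<lambda>t. \<bar>D t\<bar> * deriv v (F t)) absolutely_integrable_on ?S"
      by (rule absolutely_integrable_spike[OF prod negligible_empty]) (simp only: eq Diff_empty)
    moreover have sets_S: "?S \<in> sets lebesgue" by simp
    ultimately have "deriv v absolutely_integrable_on F ` ?S"
      using has_absolute_integral_change_of_variables_1'[of ?S F D "deriv v"] D(1) S inj_on_subset[OF inj_F S]
      by (metis (no_types, lifting) has_field_derivative_at_within subsetD sets_S)
    with diff show ?thesis by (auto simp: element_def)
  qed
  have diff: "v differentiable (at x)" if "x \<in> {a<..<b} - F ` \<zeta> ` {1..m}" for x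
    using elements_cover that local by blast
  have "deriv v absolutely_integrable_on (\<Union>j\<in>{1..m - 1}. element F \<zeta> j)"
    using local element_eq by (intro set_integrable_UN) auto
  then show int: "deriv v absolutely_integrable_on {a<..<b}"
  proof (rule absolutely_integrable_spike_set)
    show "negligible {x \<in> {a<..<b} - (\<Union>j\<in>{1..m - 1}. element F \<zeta> j). deriv v x \<noteq> 0}"
      by (rule negligible_subset[of "F ` \<zeta> ` {1..m}"]) (use elements_cover in auto)
    have "{x \<in> (\<Union>j\<in>{1..m - 1}. element F \<zeta> j) - {a<..<b}. deriv v x \<noteq> 0} = {}"
      using element_subset by blast
    then show "negligible {x \<in> (\<Union>j\<in>{1..m - 1}. element F \<zeta> j) - {a<..<b}. deriv v x \<noteq> 0}"
      by (simp only: negligible_empty)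
  qed
  show "has_weak_deriv {a<..<b} v (deriv v)"
    by (rule has_weak_deriv_piecewise_differentiable[OF less _ _ diff int])
      (use v in \<open>auto simp: V_space_def\<close>)
  show "a < b" by (fact less)
qed

end

section \<open>Comparison of total variations\<close>

lemma absolutely_integrable_sgn_mult:
  fixes f g :: "real \<Rightarrow> real"
  assumes "f absolutely_integrable_on S" "g absolutely_integrable_on S" "S \<in> sets lebesgue"
  shows "(\<lambda>x. sgn (f x) * g x) absolutely_integrable_on S"
proof (rule absolutely_integrable_bounded_measurable_product_real[OF _ assms(3) _ assms(2)])
  have "f \<in> borel_measurable (lebesgue_on S)"
    using absolutely_integrable_measurable[OF assms(3)] assms(1) by blast
  then show "(\<lambda>x. sgn (f x)) \<in> borel_measurable (lebesgue_on S)" by simp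
  show "bounded ((\<lambda>x. sgn (f x)) ` S)"
    by (auto simp: bounded_iff sgn_if intro!: exI[of _ 1])
qed

context mesh
begin

text \<open>
  With \<open>D = \<bar>h\<bar> - \<tau> h\<close> and \<open>E = \<bar>h\<bar> - \<bar>g\<bar>\<close>, the integral of \<open>D\<close> over each element is nonnegative
  and, by the Gibbs constraint, that of \<open>E\<close> is nonpositive. By \<open>total\<close> the sums of these integrals
  over all elements agree. So all of them vanish.
\<close>

lemma elementwise_variation_bound:
  fixes g h :: "real \<Rightarrow> real" and \<tau> :: real
  assumes g: "g absolutely_integrable_on {a<..<b}" and h: "h absolutely_integrable_on {a<..<b}"
    and \<tau>: "\<bar>\<tau>\<bar> = 1" and N: "negligible N" "\<And>x. x \<in> {a<..<b} - N \<Longrightarrow> 0 \<le> \<tau> * g x"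
    and gibbs: "\<And>j. j \<in> {1..m - 1} \<Longrightarrow> integral (element F \<zeta> j) (\<lambda>x. \<bar>h x\<bar> - sgn (h x) * g x) \<le> 0"
    and total: "integral {a<..<b} h = integral {a<..<b} g"
  shows "\<And>j. j \<in> {1..m - 1} \<Longrightarrow> integral (element F \<zeta> j) h = integral (element F \<zeta> j) g"
    and "\<And>x y. a < x \<Longrightarrow> y < b \<Longrightarrow> 0 \<le> \<tau> * integral {x..y} h"
proof -
  have ai: "(\<lambda>x. \<bar>h x\<bar>) absolutely_integrable_on {a<..<b}" "(\<lambda>x. \<bar>g x\<bar>) absolutely_integrable_on {a<..<b}"
      "(\<lambda>x. \<tau> * h x) absolutely_integrable_on {a<..<b}"
    using absolutely_integrable_norm[OF g] absolutely_integrable_norm[OF h] h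
    by (simp_all add: o_def set_integrable_mult_right)
  define D where "D x = \<bar>h x\<bar> - \<tau> * h x" for x
  define E where "E x = \<bar>h x\<bar> - \<bar>g x\<bar>" for x
  have D0: "0 \<le> D x" for x
    using abs_ge_self[of "\<tau> * h x"] \<tau> by (simp add: D_def abs_mult)
  have DE: "D absolutely_integrable_on {a<..<b}" "E absolutely_integrable_on {a<..<b}"
    unfolding D_def[abs_def] E_def[abs_def] by (intro set_integral_diff(1) ai)+
  have int: "f integrable_on S" if "f absolutely_integrable_on S" for f :: "real \<Rightarrow> real" and S
    using that set_lebesgue_integral_eq_integral(1) by blast
  have parts: "integral S D = integral S (\<lambda>x. \<bar>h x\<bar>) - \<tau> * integral S h"
      "integral S E = integral S (\<lambda>x. \<bar>h x\<bar>) - \<tau> * integral S g"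
    if S: "S \<subseteq> {a<..<b}" "S \<in> sets lebesgue" for S
  proof -
    have "f integrable_on S" if "f absolutely_integrable_on {a<..<b}" for f :: "real \<Rightarrow> real"
      by (rule int[OF set_integrable_subset[OF that S(2,1)]])
    then have i: "(\<lambda>x. \<bar>h x\<bar>) integrable_on S" "(\<lambda>x. \<bar>g x\<bar>) integrable_on S" "(\<lambda>x. \<tau> * h x) integrable_on S"
      using ai by blast+
    show "integral S D = integral S (\<lambda>x. \<bar>h x\<bar>) - \<tau> * integral S h"
      unfolding D_def[abs_def] using i by (simp add: integral_diff)
    have "integral S (\<lambda>x. \<bar>g x\<bar>) = integral S (\<lambda>x. \<tau> * g x)"
    proof (rule integral_spike[OF N(1)])
      fix x assume "x \<in> S - N"
      then have "0 \<le> \<tau> * g x" using N(2) S(1) by blast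
      then show "\<tau> * g x = \<bar>g x\<bar>" using \<tau> by (metis abs_mult abs_of_nonneg mult_1)
    qed
    then show "integral S E = integral S (\<lambda>x. \<bar>h x\<bar>) - \<tau> * integral S g"
      unfolding E_def[abs_def] using i by (simp add: integral_diff)
  qed
  have K: "element F \<zeta> j \<subseteq> {a<..<b}" "element F \<zeta> j \<in> sets lebesgue" if "j \<in> {1..m - 1}" for j
    using element_subset[OF that] element_eq[OF that] by auto
  have E_le: "integral (element F \<zeta> j) E \<le> 0" if j: "j \<in> {1..m - 1}" for j
  proof -
    have "integral (element F \<zeta> j) E \<le> integral (element F \<zeta> j) (\<lambda>x. \<bar>h x\<bar> - sgn (h x) * g x)"
    proof (rule integral_le)
      show "E integrable_on element F \<zeta> j"
        by (intro int absolutely_integrable_on_element DE j)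
      show "(\<lambda>x. \<bar>h x\<bar> - sgn (h x) * g x) integrable_on element F \<zeta> j"
        by (intro int set_integral_diff(1) absolutely_integrable_sgn_mult absolutely_integrable_on_element ai g h j K)
      show "E x \<le> \<bar>h x\<bar> - sgn (h x) * g x" for x
        by (auto simp: E_def sgn_if)
    qed
    then show ?thesis using gibbs[OF j] by linarith
  qed
  have D_ge: "0 \<le> integral S D" if "D integrable_on S" for S
    using that D0 by (intro integral_nonneg) auto
  have "integral {a<..<b} D = integral {a<..<b} E"
    using total by (simp add: parts)
  then have sums: "(\<Sum>j\<in>{1..m - 1}. integral (element F \<zeta> j) D) = (\<Sum>j\<in>{1..m - 1}. integral (element F \<zeta> j) E)"
    using DE by (simp only: sum_integral_elements)
  have D_el: "0 \<le> integral (element F \<zeta> j) D" if "j \<in> {1..m - 1}" for j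
    by (intro D_ge int absolutely_integrable_on_element DE that)
  have "(\<Sum>j\<in>{1..m - 1}. integral (element F \<zeta> j) E) \<le> 0"
    by (intro sum_nonpos E_le)
  moreover have "0 \<le> (\<Sum>j\<in>{1..m - 1}. integral (element F \<zeta> j) D)"
    by (intro sum_nonneg D_el)
  ultimately have zero: "(\<Sum>j\<in>{1..m - 1}. integral (element F \<zeta> j) D) = 0" "(\<Sum>j\<in>{1..m - 1}. integral (element F \<zeta> j) E) = 0"
    using sums by linarith+
  show "integral (element F \<zeta> j) h = integral (element F \<zeta> j) g" if j: "j \<in> {1..m - 1}" for j
  proof -
    have "integral (element F \<zeta> j) D = 0"
      using zero(1) D_el j by (subst (asm) sum_nonneg_eq_0_iff) auto
    moreover have "integral (element F \<zeta> j) E = 0"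
      using sum_nonneg_0[of "{1..m - 1}" "\<lambda>j. - integral (element F \<zeta> j) E" j] zero(2) E_le j
      by (simp add: sum_negf)
    ultimately have "\<tau> * integral (element F \<zeta> j) h = \<tau> * integral (element F \<zeta> j) g"
      using parts[OF K[OF j]] by linarith
    then show ?thesis using \<tau> by auto
  qed
  have "integral {a<..<b} D = 0"
    using zero(1) DE(1) by (simp only: sum_integral_elements)
  show "0 \<le> \<tau> * integral {x..y} h" if xy: "a < x" "y < b" for x y
  proof -
    have sub: "{x..y} \<subseteq> {a<..<b}" using xy by auto
    have "integral {x..y} D \<le> integral {a<..<b} D"
      using D0 sub by (intro integral_subset_le int DE set_integrable_subset[OF DE(1)]) auto
    moreover have "0 \<le> integral {x..y} (\<lambda>x. \<bar>h x\<bar>)"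
      using sub by (intro integral_nonneg int set_integrable_subset[OF ai(1)]) auto
    ultimately show ?thesis
      using parts(1)[OF sub] \<open>integral {a<..<b} D = 0\<close> by simp
  qed
qed

lemma K_set_monotone_interpolant:
  assumes "\<phi> \<in> H1 {a<..<b}" and "monotonic_on {a<..<b} (cont_rep {a<..<b} \<phi>)"
    and \<theta>: "\<theta> \<in> K_set {a<..<b} F m \<zeta> p \<phi>"
  shows "monotonic_on {a<..<b} \<theta>"
    and "\<And>j. j \<in> {1..m} \<Longrightarrow> cont_rep {a<..<b} \<theta> (F (\<zeta> j)) = cont_rep {a<..<b} \<phi> (F (\<zeta> j))"
proof -
  obtain g0 where "integrable_weak_deriv a b \<phi> g0"
    using H1_integrable_weak_deriv[OF assms(1) less] by blast
  then interpret \<phi>: integrable_weak_deriv a b \<phi> g0 .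
  have V: "\<theta> \<in> V_space {a<..<b} F m \<zeta> p"
    and trace: "\<And>x. x \<in> frontier {a<..<b} \<Longrightarrow> cont_rep {a<..<b} \<theta> x = cont_rep {a<..<b} \<phi> x"
    and gibbs: "\<And>j. j \<in> {1..m - 1} \<Longrightarrow> gibbs {a<..<b} \<phi> (element F \<zeta> j) \<theta> \<le> 0"
    using \<theta> by (auto simp: K_set_def V_D_space_def)
  interpret \<theta>: integrable_weak_deriv a b \<theta> "deriv \<theta>"
    by (rule V_space_derivative[OF V])
  define w where "w = cont_rep {a<..<b} \<phi>"
  define wh where "wh = cont_rep {a<..<b} \<theta>"
  define g where "g = weak_deriv {a<..<b} \<phi>"
  define h where "h = weak_deriv {a<..<b} \<theta>"
  have gh: "g absolutely_integrable_on {a<..<b}" "h absolutely_integrable_on {a<..<b}"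
    unfolding g_def h_def by (fact \<phi>.absolutely_integrable_weak_deriv \<theta>.absolutely_integrable_weak_deriv)+
  have FTC: "integral {x..y} g = w y - w x" "integral {x..y} h = wh y - wh x" if "a \<le> x" "x \<le> y" "y \<le> b" for x y
    unfolding g_def h_def w_def wh_def using \<phi>.integral_weak_deriv[OF that] \<theta>.integral_weak_deriv[OF that] .
  have ends: "wh a = w a" "wh b = w b"
    using trace less by (auto simp: w_def wh_def frontier_def)
  obtain \<tau> :: real where \<tau>: "\<bar>\<tau>\<bar> = 1" "\<And>x y. a < x \<Longrightarrow> x < y \<Longrightarrow> y < b \<Longrightarrow> 0 \<le> \<tau> * (w y - w x)"
  proof (cases "mono_on {a<..<b} w")
    case True
    then have "0 \<le> 1 * (w y - w x)" if "a < x" "x < y" "y < b" for x y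
      using that by (auto simp: monotone_on_def)
    then show thesis using that[of 1] by simp
  next
    case False
    then have "antimono_on {a<..<b} w"
      using assms(2) by (simp add: monotonic_on_def w_def)
    then have "0 \<le> - 1 * (w y - w x)" if "a < x" "x < y" "y < b" for x y
      using that by (auto simp: monotone_on_def)
    then show thesis using that[of "- 1"] by simp
  qed
  have "(\<lambda>x. \<tau> * g x) absolutely_integrable_on {a<..<b}"
    using gh(1) by (simp add: set_integrable_mult_right)
  then have loc: "(\<lambda>x. \<tau> * g x) locally_integrable_on {a<..<b}"
    unfolding locally_integrable_on_def using set_integrable_subset lmeasurable_compact by blast
  have pos: "0 \<le> integral {x..y} (\<lambda>x. \<tau> * g x)" if "a < x" "x < y" "y < b" for x y
    using \<tau>(2)[OF that] FTC(1)[of x y] that by simp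
  obtain N where N: "negligible N" "\<And>x. x \<in> {a<..<b} - N \<Longrightarrow> 0 \<le> \<tau> * g x"
    using AE_nonneg_if_interval_integrals_nonneg[OF loc pos] by metis
  have gibbs_gh: "integral (element F \<zeta> j) (\<lambda>x. \<bar>h x\<bar> - sgn (h x) * g x) \<le> 0" if j: "j \<in> {1..m - 1}" for j
  proof -
    have K: "element F \<zeta> j \<in> sets lebesgue" using element_eq[OF j] by simp
    have ai: "(\<lambda>x. \<bar>h x\<bar> - sgn (h x) * g x) absolutely_integrable_on element F \<zeta> j"
      using absolutely_integrable_norm[OF gh(2)]
      by (intro set_integral_diff(1) absolutely_integrable_sgn_mult absolutely_integrable_on_element gh j K) (simp add: o_def)
    show ?thesis
      using gibbs[OF j] lebesgue_integral_eq_integral[OF absolutely_integrable_imp_integrable[OF ai K] K]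
      unfolding gibbs_def g_def h_def by linarith
  qed
  have "integral {a<..<b} h = integral {a<..<b} g"
    using FTC[of a b] ends less by (simp flip: integral_open_interval_real)
  note bound = elementwise_variation_bound[OF gh \<tau>(1) N(1) _ _ this]
  have el: "integral (element F \<zeta> j) h = integral (element F \<zeta> j) g" if "j \<in> {1..m - 1}" for j
    by (rule bound(1)[OF _ _ that]) (fact N(2) gibbs_gh)+
  have sign: "0 \<le> \<tau> * integral {x..y} h" if "a < x" "y < b" for x y
    by (rule bound(2)[OF _ _ that]) (fact N(2) gibbs_gh)+
  have cont: "continuous_on {a<..<b} \<theta>"
    using V by (simp add: V_space_def)
  have incr: "0 \<le> \<tau> * (\<theta> y - \<theta> x)" if xy: "a < x" "x \<le> y" "y < b" for x y
  proof (cases "x = y")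
    case False
    then have "integral {x..y} h = \<theta> y - \<theta> x"
      unfolding h_def using xy by (intro weak_FTC_continuous[OF \<theta>.has_weak_deriv_weak_deriv cont]) auto
    then show ?thesis using sign[of x y] xy by simp
  qed simp
  from \<tau>(1) consider "\<tau> = 1" | "\<tau> = - 1" by linarith
  then show "monotonic_on {a<..<b} \<theta>"
  proof cases
    case 1
    then have "mono_on {a<..<b} \<theta>"
      using incr by (auto simp: monotone_on_def)
    then show ?thesis by (simp add: monotonic_on_def)
  next
    case 2
    then have "antimono_on {a<..<b} \<theta>"
      using incr by (auto simp: monotone_on_def)
    then show ?thesis by (simp add: monotonic_on_def)
  qed
  have node_step: "wh (F (\<zeta> (j + 1))) - w (F (\<zeta> (j + 1))) = wh (F (\<zeta> j)) - w (F (\<zeta> j))" if j: "j \<in> {1..m - 1}" for j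
  proof -
    \<comment> \<open>as \<open>F\<close> may be decreasing, the left end of the element is either of the two nodes\<close>
    define L U where LU: "L = min (F (\<zeta> j)) (F (\<zeta> (j + 1)))" "U = max (F (\<zeta> j)) (F (\<zeta> (j + 1)))"
    have "a \<le> L" "L \<le> U" "U \<le> b"
      using node_bounds[OF element_indices(1)[OF j]] node_bounds[OF element_indices(2)[OF j]] by (auto simp: LU)
    then have "wh U - wh L = w U - w L"
      using el[OF j] FTC[of L U] unfolding element_eq[OF j] LU[symmetric] by (simp flip: integral_open_interval_real)
    then show ?thesis
      by (auto simp: LU min_def max_def split: if_splits)
  qed
  show "cont_rep {a<..<b} \<theta> (F (\<zeta> j)) = cont_rep {a<..<b} \<phi> (F (\<zeta> j))" if "j \<in> {1..m}" for j
  proof -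
    have "1 \<le> j" "j \<le> m" using that by auto
    then have "wh (F (\<zeta> j)) - w (F (\<zeta> j)) = 0"
    proof (induction j rule: dec_induct)
      case base
      have "\<zeta> 1 = - 1" using kn by (simp add: knots_def)
      moreover have "F (- 1) = a \<or> F (- 1) = b"
        using F_ends by (auto simp: min_def max_def split: if_splits)
      ultimately show ?case using ends by auto
    next
      case (step n)
      then show ?case using node_step[of n] by auto
    qed
    then show ?thesis by (simp add: w_def wh_def)
  qed
qed

end

theorem theorem4p5:
  fixes a b :: real and \<Omega> :: "real set"
    and F :: "real \<Rightarrow> real" and m p :: nat and \<zeta> :: "nat \<Rightarrow> real"
    and \<phi> \<phi>h :: "real \<Rightarrow> real"
    and H :: "(real \<Rightarrow> real) set"
    and ip :: "(real \<Rightarrow> real) \<Rightarrow> (real \<Rightarrow> real) \<Rightarrow> real"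
  assumes "a < b" and "\<Omega> = {a<..<b}"
    and "parametrizes F \<Omega>"
    and "knots m \<zeta>"
    and "\<phi> \<in> H1 \<Omega>" and "monotonic_on \<Omega> (cont_rep \<Omega> \<phi>)"
    and "1 \<le> p"
    and "inner_product_on \<Omega> H ip"
    and "\<forall>\<theta>\<in>K_set \<Omega> F m \<zeta> p \<phi>. (\<lambda>x. \<phi> x - \<theta> x) \<in> H"
    and "is_arg_min (\<lambda>\<theta>. induced_norm ip (\<lambda>x. \<phi> x - \<theta> x))
           (\<lambda>\<theta>. \<theta> \<in> K_set \<Omega> F m \<zeta> p \<phi>) \<phi>h"
  shows "monotonic_on \<Omega> \<phi>h \<and>
         (\<forall>j\<in>{1..m}. cont_rep \<Omega> \<phi>h (F (\<zeta> j)) = cont_rep \<Omega> \<phi> (F (\<zeta> j)))"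
proof -
  interpret mesh a b F m \<zeta>
    using assms by unfold_locales auto
  have "\<phi>h \<in> K_set {a<..<b} F m \<zeta> p \<phi>"
    using assms(2,10) by (simp add: is_arg_min_def)
  from K_set_monotone_interpolant[OF _ _ this] assms(2,5,6) show ?thesis by blast
qed

end
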